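(* Suppose we have a shadow of a rational two-component link coming from a closure of a rational tangle; that is, let $(a_1,\ldots,a_n)$ be a rational tangle word ($a_i\in\mathbb{Z}$) such that one of the two closures (numerator or denominator) of the rational tangle $(a_1,\ldots,a_n)$ is a 2-component link diagram, and consider the Linking-Unlinking Game played on the shadow of this 2-component closure. (1) If the tangle word contains an even number of self-intersections, then the second player has a winning strategy, regardless of their role (Linker or Unlinker). (2) If the tangle word contains an odd number of self-intersections, then the first player has a winning strategy, regardless of their role (Linker or Unlinker).
   Context: Link projections. A link shadow is a projection of a link to the plane $\mathbb{R}^2$ in which all crossings are transverse double crossings, with no over/under information. Resolving a crossing means choosing which of its two strands is the overstrand; each crossing has two possible resolutions. A link diagram is a link projection in which every crossing has been resolved. Two link diagrams are equivalent if they are related by a finite sequence of Reidemeister moves and planar isotopies. A link diagram is splittable if it is equivalent to a diagram in which one or more components lie entirely inside a circle in the plane and the other components lie entirely outside it; otherwise it is unsplittable. The Linking-Unlinking Game. It is a two-player game played on the shadow of a 2-component link. Players take turns resolving crossings of the shadow, until all crossings are resolved and a 2-component link diagram is formed. One player, the Linker, wins if the resulting diagram is unsplittable; the other player, the Unlinker, wins if it is splittable. Either of the two may move first; the "first player" is the one who makes the first move and the "second player" is the other one. A player has a winning strategy if there is always a sequence of moves that allows them to win, regardless of what their opponent does. Rational tangles. For integers $a_1,\ldots,a_n$, the rational tangle $(a_1,\ldots,a_n)$ is the tangle diagram with four endpoints NW, NE, SW, SE constructed as follows. Start with two parallel vertical strands (one joining NW to SW, the other joining NE to SE). Read the word from left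 to right: first twist the bottom two endpoints (SW, SE) about each other $|a_1|$ times (half-twists, one crossing each), then twist the right two endpoints (NE, SE) $|a_2|$ times, then the bottom two endpoints $|a_3|$ times, and so on, alternating: even-indexed syllables twist the right two endpoints, odd-indexed syllables twist the bottom two endpoints. If $a_i>0$ (resp. $a_i<0$), the overstrand at each crossing of the $i$th syllable has positive (resp. negative) slope. The $a_i$ are the syllables of the rational tangle word. The numerator closure connects the top endpoints NW and NE together and the bottom endpoints SW and SE together; the denominator closure connects the left endpoints NW and SW together and the right endpoints NE and SE together (outside the tangle, without new crossings). Self-intersections. A crossing of the tangle is a self-intersection (SI) if both arcs meeting there belong to the same one of the two strands of the tangle, and a non-self-intersection (NSI) if it is a crossing between the two different strands.
   Formalization: The formal theorem also assumes that the tangle has at least one non-self-intersection; without it the claim fails (e.g. for the word (0) with denominator closure every resolution is split, so the Linker can never win). *)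

theory Defs
  imports Main
begin

section \<open>Tangle diagrams as words of elementary pieces\<close>

text \<open>
  A link or tangle diagram in general position with respect to the height function of the plane is
  read from top to bottom as a finite word of elementary pieces, one critical level at a time.
  Between consecutive levels the diagram is a row of vertical strands, numbered
  \<open>0, 1, 2, \<dots>\<close> from left to right. The pieces are

  \<^item> \<open>Cap i\<close>: a local maximum (shape of the set-theoretic intersection sign), whose two legs
    become the strands \<open>i\<close> and \<open>i + 1\<close>;
  \<^item> \<open>Cup i\<close>: a local minimum, joining the strands \<open>i\<close> and \<open>i + 1\<close>;
  \<^item> \<open>Cross i x\<close>: a transverse crossing of the strands \<open>i\<close> and \<open>i + 1\<close>, with label \<open>x\<close>.

  The label type carries the over/under information: \<open>unit\<close> for a shadow, \<open>slope\<close> for a diagram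
  (the slope of the overstrand), and \<open>slope option\<close> for a partially resolved shadow.
\<close>

datatype slope = Positive | Negative

fun flip :: "slope \<Rightarrow> slope" where
  "flip Positive = Negative"
| "flip Negative = Positive"

datatype 'x step = Cap nat | Cup nat | Cross nat 'x

primrec pos :: "'x step \<Rightarrow> nat" where
  "pos (Cap i) = i"
| "pos (Cup i) = i"
| "pos (Cross i x) = i"

primrec ins :: "'x step \<Rightarrow> nat" where
  "ins (Cap i) = 0"
| "ins (Cup i) = 2"
| "ins (Cross i x) = 2"

primrec outs :: "'x step \<Rightarrow> nat" where
  "outs (Cap i) = 2"
| "outs (Cup i) = 0"
| "outs (Cross i x) = 2"

primrec shift_step :: "nat \<Rightarrow> 'x step \<Rightarrow> 'x step" where
  "shift_step k (Cap i) = Cap (k + i)"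
| "shift_step k (Cup i) = Cup (k + i)"
| "shift_step k (Cross i x) = Cross (k + i) x"

text \<open>\<open>tangle n w m\<close>: the word \<open>w\<close> is a diagram with \<open>n\<close> endpoints at the top and \<open>m\<close> at the
  bottom.\<close>

fun tangle :: "nat \<Rightarrow> 'x step list \<Rightarrow> nat \<Rightarrow> bool" where
  "tangle n [] m \<longleftrightarrow> n = m"
| "tangle n (s # w) m \<longleftrightarrow> pos s + ins s \<le> n \<and> tangle (n - ins s + outs s) w m"

definition closed :: "'x step list \<Rightarrow> bool" where
  "closed w \<longleftrightarrow> tangle 0 w 0"


section \<open>Components and self-intersections\<close>

text \<open>A node \<open>(h, p)\<close> is the piece of the \<open>p\<close>-th strand just above the \<open>h\<close>-th step of the word
  (just below the last step if \<open>h\<close> is the length of the word).\<close>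

fun width :: "nat \<Rightarrow> 'x step list \<Rightarrow> nat" where
  "width n [] = n"
| "width n (s # w) = width (n - ins s + outs s) w"

definition nodes :: "nat \<Rightarrow> 'x step list \<Rightarrow> (nat \<times> nat) set" where
  "nodes n w = {(h, p). h \<le> length w \<and> p < width n (take h w)}"

inductive adjacent :: "'x step list \<Rightarrow> nat \<times> nat \<Rightarrow> nat \<times> nat \<Rightarrow> bool" for w where
  left: "h < length w \<Longrightarrow> p < pos (w ! h) \<Longrightarrow> adjacent w (h, p) (Suc h, p)"
| right: "h < length w \<Longrightarrow> pos (w ! h) + ins (w ! h) \<le> p \<Longrightarrow>
    adjacent w (h, p) (Suc h, p - ins (w ! h) + outs (w ! h))"
| cap: "h < length w \<Longrightarrow> w ! h = Cap i \<Longrightarrow> adjacent w (Suc h, i) (Suc h, Suc i)"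
| cup: "h < length w \<Longrightarrow> w ! h = Cup i \<Longrightarrow> adjacent w (h, i) (h, Suc i)"
| cross_down: "h < length w \<Longrightarrow> w ! h = Cross i x \<Longrightarrow> adjacent w (h, i) (Suc h, Suc i)"
| cross_up: "h < length w \<Longrightarrow> w ! h = Cross i x \<Longrightarrow> adjacent w (h, Suc i) (Suc h, i)"

definition same_component :: "'x step list \<Rightarrow> nat \<times> nat \<Rightarrow> nat \<times> nat \<Rightarrow> bool" where
  "same_component w = equivclp (adjacent w)"

definition components :: "nat \<Rightarrow> 'x step list \<Rightarrow> (nat \<times> nat) set set" where
  "components n w = (\<lambda>x. {y \<in> nodes n w. same_component w x y}) ` nodes n w"

definition two_component_link :: "'x step list \<Rightarrow> bool" where
  "two_component_link w \<longleftrightarrow> closed w \<and> card (components 0 w) = 2"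

definition self_intersections :: "'x step list \<Rightarrow> nat set" where
  "self_intersections w =
    {h. h < length w \<and> (\<exists>i x. w ! h = Cross i x \<and> same_component w (h, i) (h, Suc i))}"

definition non_self_intersections :: "'x step list \<Rightarrow> nat set" where
  "non_self_intersections w =
    {h. h < length w \<and> (\<exists>i x. w ! h = Cross i x \<and> \<not> same_component w (h, i) (h, Suc i))}"


section \<open>Equivalence of diagrams and splittability\<close>

text \<open>
  Planar isotopies between diagrams in general position are generated by: exchanging the heights
  of two pieces lying side by side, cancelling a maximum against an adjacent minimum, and sliding
  a strand across a maximum or a minimum (which reverses the slope of the overstrand). In
  \<open>exchange\<close>, the piece \<open>t\<close> lies to the right of \<open>s\<close>; its position is
  changed by the number of strands that \<open>s\<close> creates or removes.
\<close>

inductive isotopy_move :: "slope step list \<Rightarrow> slope step list \<Rightarrow> bool" where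
  exchange: "pos s \<le> pos t \<Longrightarrow>
    isotopy_move [s, shift_step (outs s) t] [shift_step (ins s) t, s]"
| zigzag_left: "isotopy_move [Cap i, Cup (Suc i)] []"
| zigzag_right: "isotopy_move [Cap (Suc i), Cup i] []"
| slide_cap: "isotopy_move [Cap i, Cross (Suc i) x] [Cap (Suc i), Cross i (flip x)]"
| slide_cup: "isotopy_move [Cross (Suc i) x, Cup i] [Cross i (flip x), Cup (Suc i)]"

text \<open>In the third move, the condition on the labels says that one of the three strands lies above
  both others and one lies below both others. The variants of the three moves in which strands are
  bent differently in the vertical direction arise by combining these with isotopy moves.\<close>

inductive reidemeister_move :: "slope step list \<Rightarrow> slope step list \<Rightarrow> bool" where
  R1_cap: "reidemeister_move [Cap i, Cross i x] [Cap i]"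
| R1_cup: "reidemeister_move [Cross i x, Cup i] [Cup i]"
| R2: "reidemeister_move [Cross i x, Cross i (flip x)] []"
| R3: "x = y \<or> y = z \<Longrightarrow> reidemeister_move
    [Cross i x, Cross (Suc i) y, Cross i z] [Cross (Suc i) z, Cross i y, Cross (Suc i) x]"

inductive diagram_step :: "slope step list \<Rightarrow> slope step list \<Rightarrow> bool" where
  "isotopy_move l r \<or> reidemeister_move l r \<Longrightarrow> closed (u @ l @ v) \<Longrightarrow> closed (u @ r @ v) \<Longrightarrow>
    diagram_step (u @ l @ v) (u @ r @ v)"

definition equivalent :: "slope step list \<Rightarrow> slope step list \<Rightarrow> bool" where
  "equivalent = equivclp diagram_step"

text \<open>
  \<open>A @ map (shift_step k) L @ B\<close> is the diagram \<open>A @ B\<close> with the closed diagram \<open>L\<close> placed between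
  its strands \<open>k - 1\<close> and \<open>k\<close>, at the level between \<open>A\<close> and \<open>B\<close>: a circle around \<open>L\<close> has
  exactly \<open>L\<close> inside it and exactly \<open>A @ B\<close> outside it. Conversely a disc bounded by a circle disjoint
  from the diagram can be brought into this position by a planar isotopy. A nonempty closed word
  has at least one component.
\<close>

definition separated_by_circle :: "slope step list \<Rightarrow> bool" where
  "separated_by_circle D \<longleftrightarrow> (\<exists>A L B k. D = A @ map (shift_step k) L @ B \<and> closed D \<and>
    closed L \<and> closed (A @ B) \<and> L \<noteq> [] \<and> A @ B \<noteq> [])"

definition splittable :: "slope step list \<Rightarrow> bool" where
  "splittable D \<longleftrightarrow> (\<exists>D'. equivalent D D' \<and> separated_by_circle D')"


section \<open>Rational tangles\<close>

text \<open>
  Tangles with four endpoints have NW, NE as top and SW, SE as bottom endpoints. Twisting the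
  right endpoints puts an upright crossing to the right of \<open>T\<close>: its upper left end is joined to
  the NE end of \<open>T\<close> by a cap, its lower left end to the SE end of \<open>T\<close> by a cup, and its two
  right ends are the new NE and SE endpoints.
\<close>

definition twist_bottom :: "slope \<Rightarrow> slope step list \<Rightarrow> slope step list" where
  "twist_bottom x T = T @ [Cross 0 x]"

definition twist_right :: "slope \<Rightarrow> slope step list \<Rightarrow> slope step list" where
  "twist_right x T = [Cap 1] @ T @ [Cross 2 x, Cup 1]"

definition slope_of :: "int \<Rightarrow> slope" where
  "slope_of k = (if k > 0 then Positive else Negative)"

definition add_syllable :: "nat \<times> int \<Rightarrow> slope step list \<Rightarrow> slope step list" where
  "add_syllable = (\<lambda>(i, k).
    (if odd i then twist_bottom (slope_of k) else twist_right (slope_of k)) ^^ nat \<bar>k\<bar>)"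

definition rational_tangle :: "int list \<Rightarrow> slope step list" where
  "rational_tangle a = fold add_syllable (enumerate 1 a) []"

datatype closure_kind = Numerator | Denominator

fun tangle_closure :: "closure_kind \<Rightarrow> 'x step list \<Rightarrow> 'x step list" where
  "tangle_closure Numerator T = [Cap 0] @ T @ [Cup 0]"
| "tangle_closure Denominator T = [Cap 0, Cap 2] @ map (shift_step 1) T @ [Cup 2, Cup 0]"


section \<open>The Linking-Unlinking Game\<close>

definition shadow :: "'x step list \<Rightarrow> unit step list" where
  "shadow = map (map_step (\<lambda>_. ()))"

type_synonym position = "slope option step list"

definition initial_position :: "unit step list \<Rightarrow> position" where
  "initial_position = map (map_step (\<lambda>_. None))"

inductive legal_move :: "position \<Rightarrow> position \<Rightarrow> bool" where
  "h < length P \<Longrightarrow> P ! h = Cross i None \<Longrightarrow> legal_move P (P[h := Cross i (Some x)])"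

definition all_resolved :: "position \<Rightarrow> bool" where
  "all_resolved P \<longleftrightarrow> (\<forall>i. Cross i None \<notin> set P)"

definition final_diagram :: "position \<Rightarrow> slope step list" where
  "final_diagram = map (map_step the)"

datatype player = Linker | Unlinker

fun opponent :: "player \<Rightarrow> player" where
  "opponent Linker = Unlinker"
| "opponent Unlinker = Linker"

fun wins :: "player \<Rightarrow> slope step list \<Rightarrow> bool" where
  "wins Linker D \<longleftrightarrow> \<not> splittable D"
| "wins Unlinker D \<longleftrightarrow> splittable D"

text \<open>A history is the nonempty list of all positions so far, the initial one included;
  \<open>first\<close> is the player making the first move.\<close>

definition to_move :: "player \<Rightarrow> position list \<Rightarrow> player" where
  "to_move first H = (if odd (length H) then first else opponent first)"

text \<open>The histories that can arise when player \<open>p\<close> follows the strategy \<open>\<sigma>\<close>.\<close>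

inductive follows :: "player \<Rightarrow> player \<Rightarrow> unit step list \<Rightarrow> (position list \<Rightarrow> position) \<Rightarrow>
    position list \<Rightarrow> bool" for p first S \<sigma> where
  start: "follows p first S \<sigma> [initial_position S]"
| own_move: "follows p first S \<sigma> H \<Longrightarrow> \<not> all_resolved (last H) \<Longrightarrow> to_move first H = p \<Longrightarrow>
    follows p first S \<sigma> (H @ [\<sigma> H])"
| opponent_move: "follows p first S \<sigma> H \<Longrightarrow> to_move first H = opponent p \<Longrightarrow>
    legal_move (last H) P \<Longrightarrow> follows p first S \<sigma> (H @ [P])"

definition winning_strategy :: "player \<Rightarrow> player \<Rightarrow> unit step list \<Rightarrow>
    (position list \<Rightarrow> position) \<Rightarrow> bool" where
  "winning_strategy p first S \<sigma> \<longleftrightarrow> (\<forall>H. follows p first S \<sigma> H \<longrightarrow>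
    (if all_resolved (last H) then wins p (final_diagram (last H))
     else to_move first H = p \<longrightarrow> legal_move (last H) (\<sigma> H)))"

definition has_winning_strategy :: "player \<Rightarrow> player \<Rightarrow> unit step list \<Rightarrow> bool" where
  "has_winning_strategy p first S \<longleftrightarrow> (\<exists>\<sigma>. winning_strategy p first S \<sigma>)"


section \<open>Well-formedness of rational tangles and their closures\<close>

lemma tangle_append: "tangle n u k \<Longrightarrow> tangle k v m \<Longrightarrow> tangle n (u @ v) m"
  by (induction u arbitrary: n) auto

lemma tangle_strands_right: "tangle n w m \<Longrightarrow> tangle (n + k) w (m + k)"
proof (induction w arbitrary: n)
  case (Cons s w)
  then have le: "pos s + ins s \<le> n" and "tangle (n - ins s + outs s) w m"
    by (simp_all only: tangle.simps)
  from Cons.IH[OF this(2)] have "tangle (n - ins s + outs s + k) w (m + k)" .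
  moreover from le have "n + k - ins s + outs s = n - ins s + outs s + k"
    by simp
  ultimately show ?case using le by (simp only: tangle.simps) simp
qed simp

lemma tangle_strands_left: "tangle n w m \<Longrightarrow> tangle (k + n) (map (shift_step k) w) (k + m)"
proof (induction w arbitrary: n)
  case (Cons s w)
  then have le: "pos s + ins s \<le> n" and "tangle (n - ins s + outs s) w m"
    by (simp_all only: tangle.simps)
  from Cons.IH[OF this(2)]
  have "tangle (k + (n - ins s + outs s)) (map (shift_step k) w) (k + m)" .
  moreover from le have "k + n - ins s + outs s = k + (n - ins s + outs s)"
    by simp
  moreover have "ins (shift_step k s) = ins s" "outs (shift_step k s) = outs s"
      "pos (shift_step k s) = k + pos s"
    by (cases s; simp)+
  ultimately show ?case using le by (simp only: tangle.simps list.map) simp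
qed simp

lemma tangle_add_syllable:
  assumes "tangle 2 T 2"
  shows "tangle 2 (add_syllable ik T) 2"
proof -
  have bottom: "tangle 2 (twist_bottom x U) 2" if "tangle 2 U 2" for x U
    unfolding twist_bottom_def by (rule tangle_append[OF that]) simp
  have right: "tangle 2 (twist_right x U) 2" if "tangle 2 U 2" for x U
    using tangle_append[OF tangle_strands_right[OF that, of 2], of "[Cross 2 x, Cup 1]" 2]
    by (simp add: twist_right_def)
  have "tangle 2 ((twist_bottom x ^^ j) T) 2" "tangle 2 ((twist_right x ^^ j) T) 2" for x j
    by (induction j) (use assms bottom right in auto)
  then show ?thesis
    by (auto simp: add_syllable_def split: prod.splits)
qed

lemma tangle_rational_tangle: "tangle 2 (rational_tangle a) 2"
proof -
  have "tangle 2 (fold add_syllable xs T) 2" if "tangle 2 T 2" for xs T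
    using that by (induction xs arbitrary: T) (auto intro: tangle_add_syllable)
  then show ?thesis by (simp add: rational_tangle_def)
qed

lemma closed_tangle_closure:
  assumes "tangle 2 T 2"
  shows "closed (tangle_closure c T)"
proof (cases c)
  case Numerator
  then show ?thesis
    using tangle_append[OF assms, of "[Cup 0]" 0]
    by (simp add: closed_def numeral_2_eq_2)
next
  case Denominator
  have "1 + 2 + 1 = (4 :: nat)" by simp
  then have "tangle 4 (map (shift_step 1) T) 4"
    using tangle_strands_right[OF tangle_strands_left[OF assms, of 1], of 1] by metis
  from tangle_append[OF this, of "[Cup 2, Cup 0]" 0] Denominator show ?thesis
    by (simp add: closed_def eval_nat_numeral)
qed

end

theory Submission
  imports Defs
begin

text \<open>
  Build the tangle one crossing at a time and keep track of how its four ends are joined: by two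
  vertical arcs, crosswise, or by two horizontal arcs. A twist is a self-intersection exactly if it
  does not change this connection type, every other twist enters or leaves the crosswise type, and a
  2-component closure needs the final type to be one of the other two. Hence the
  non-self-intersections come in pairs of consecutive ones.

  The Unlinker gives the two crossings of each pair opposite slopes. Then the tangle is equivalent to
  the crossingless vertical or horizontal tangle whenever its type is not crosswise, whatever happens
  at the self-intersections. The Linker resolves the last non-self-intersection so that the linking
  number is nonzero. Both strategies answer a non-self-intersection by another one, so they only need
  the opponent to be the first to run out of self-intersections: this is the parity in the theorem.
\<close>

section \<open>Labelled diagrams and the linking number\<close>

text \<open>The obstacle is to exclude every sequence of moves that might split a linked diagram.
  Moves change the nodes, so the linking number is not attached to fixed components. What is shown
  invariant instead is the collection of all pairs of a label set and a total that the runs of a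
  diagram realise. A diagram separated by a circle realises total 0 with both colours present,
  because inside and outside can be coloured independently; a rational closure with nonzero linking
  number does not. Orientability is never proved in general: an orientation of the rational closure
  is carried along the moves.

  The Linker succeeds because every non-self-intersection enters the linking number with coefficient
  1 or -1, so the two resolutions of the last one give different values and at most one of them is
  0. The Unlinker succeeds because two opposite slopes cancel for both ways of leaving the crosswise
  type: directly by the second Reidemeister move, or after each crossing has been turned by a slide.
  The existence of a non-self-intersection is essential for the Linker: without one, every
  resolution is splittable.\<close>

lemma tangle_unique: "tangle n w m \<Longrightarrow> tangle n w m' \<Longrightarrow> m = m'"
  by (induction w arbitrary: n) auto

lemma tangle_append_iff: "tangle n (u @ v) m \<longleftrightarrow> (\<exists>k. tangle n u k \<and> tangle k v m)"
  by (induction u arbitrary: n) auto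

lemma pos_shift_step [simp]: "pos (shift_step k t) = k + pos t"
  and ins_shift_step [simp]: "ins (shift_step k t) = ins t"
  and outs_shift_step [simp]: "outs (shift_step k t) = outs t"
  by (cases t; simp)+

lemma shift_step_0 [simp]: "shift_step 0 t = t"
  by (cases t) auto

lemma map_shift_step_0 [simp]: "map (shift_step 0) w = w"
  by (simp add: map_idI)

lemma shift_step_add: "shift_step j (shift_step k t) = shift_step (j + k) t"
  by (cases t) auto

definition sgn_slope :: "slope \<Rightarrow> int" where
  "sgn_slope x = (if x = Positive then 1 else -1)"

lemma sgn_slope_flip [simp]: "sgn_slope (flip x) = - sgn_slope x"
  by (cases x) (auto simp: sgn_slope_def)

definition total :: "(slope \<times> int) list \<Rightarrow> int" where
  "total tr = (\<Sum>(x, v)\<leftarrow>tr. sgn_slope x * v)"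

lemma total_simps [simp]: "total [] = 0" "total ((x, v) # tr) = sgn_slope x * v + total tr"
  "total (tr @ tr') = total tr + total tr'"
  by (auto simp: total_def)

text \<open>
  Strands carry labels, which a crossing exchanges and a local maximum or minimum changes by \<open>bar\<close>.
  With \<open>\<sigma> = -1\<close> a label is a component together with a direction and \<open>B\<close> gives the sign of a
  crossing; with \<open>\<sigma> = 1\<close> and \<open>bar = id\<close> a label is just a component and \<open>B\<close> detects
  non-self-intersections.
\<close>

locale labelling =
  fixes bar :: "'l \<Rightarrow> 'l" and B :: "'l \<Rightarrow> 'l \<Rightarrow> int" and \<sigma> :: int
  assumes bar_bar [simp]: "bar (bar x) = x"
    and B_bar: "B (bar x) y = \<sigma> * B x y"
    and B_sym: "B x y = B y x"
    and B_self [simp]: "B x x = 0"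
    and s_square: "\<sigma> * \<sigma> = 1"
begin

lemma B_bar_right: "B x (bar y) = \<sigma> * B x y"
  using B_bar B_sym by metis

lemma B_bar_self [simp]: "B (bar x) x = 0" "B x (bar x) = 0"
  by (auto simp: B_bar B_bar_right)

inductive piece :: "'x step \<Rightarrow> 'l list \<Rightarrow> 'l list \<Rightarrow> ('x \<times> int) list \<Rightarrow> bool" where
  cap: "piece (Cap i) [] [x, bar x] []"
| cup: "piece (Cup i) [x, bar x] [] []"
| cross: "piece (Cross i c) [x, y] [y, x] [(c, B x y)]"

inductive_simps piece_simps: "piece (Cap i) p p' tr" "piece (Cup i) p p' tr"
  "piece (Cross i c) p p' tr"

lemma piece_lengths: "piece t p p' tr \<Longrightarrow> length p = ins t \<and> length p' = outs t"
  by (auto elim: piece.cases)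

lemma piece_shift_step [simp]: "piece (shift_step k t) p p' tr \<longleftrightarrow> piece t p p' tr"
  by (cases t) (auto simp: piece_simps)

definition lstep :: "'x step \<Rightarrow> 'l list \<Rightarrow> 'l list \<Rightarrow> ('x \<times> int) list \<Rightarrow> bool" where
  "lstep t r r' tr \<longleftrightarrow>
    (\<exists>a b p p'. r = a @ p @ b \<and> r' = a @ p' @ b \<and> length a = pos t \<and> piece t p p' tr)"

lemma lstep_iff: "lstep t r r' tr \<longleftrightarrow> pos t + ins t \<le> length r \<and>
  (\<exists>p'. piece t (take (ins t) (drop (pos t) r)) p' tr \<and>
    r' = take (pos t) r @ p' @ drop (pos t + ins t) r)" (is "_ \<longleftrightarrow> ?R")
proof
  assume "lstep t r r' tr"
  then show ?R unfolding lstep_def using piece_lengths by fastforce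
next
  assume R: ?R
  then obtain p' where p': "piece t (take (ins t) (drop (pos t) r)) p' tr"
    "r' = take (pos t) r @ p' @ drop (pos t + ins t) r" by blast
  have "r = take (pos t) r @ take (ins t) (drop (pos t) r) @ drop (pos t + ins t) r"
    by (metis add.commute append_take_drop_id drop_drop)
  with p' R show "lstep t r r' tr" unfolding lstep_def
    by (metis add_leD1 length_take min_absorb2)
qed

lemma lstep_length:
  "lstep t r r' tr \<Longrightarrow> pos t + ins t \<le> length r \<and> length r' = length r - ins t + outs t"
  unfolding lstep_def using piece_lengths by fastforce

text \<open>Closing up under \<open>bar\<close> makes the collected labels invariant under
  straightening a zigzag, whose middle strand carries the \<open>bar\<close> of the label on the
  other two.\<close>

definition labs :: "'l list \<Rightarrow> 'l set" where
  "labs r = set r \<union> bar ` set r"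

lemma labs_simps [simp]: "labs [] = {}" "labs (x # r) = {x, bar x} \<union> labs r"
  "labs (r @ r') = labs r \<union> labs r'"
  by (auto simp: labs_def)

text \<open>In \<open>run w r r' tr C\<close>, \<open>tr\<close> lists the crossings with their values of \<open>B\<close>, and \<open>C\<close> collects all
  labels that occur in some row, closed under \<open>bar\<close>.\<close>

inductive run :: "'x step list \<Rightarrow> 'l list \<Rightarrow> 'l list \<Rightarrow> ('x \<times> int) list \<Rightarrow> 'l set \<Rightarrow> bool" where
  Nil: "run [] r r [] (labs r)"
| Cons: "lstep t r r' tr \<Longrightarrow> run w r' r'' tr' C \<Longrightarrow> run (t # w) r r'' (tr @ tr') (labs r \<union> C)"

inductive_simps run_Nil: "run [] r r' tr C"
inductive_simps run_Cons: "run (t # w) r r' tr C"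

lemma run_tangle: "run w r r' tr C \<Longrightarrow> tangle (length r) w (length r')"
  by (induction rule: run.induct) (auto dest: lstep_length)

lemma run_labs: "run w r r' tr C \<Longrightarrow> labs r \<subseteq> C \<and> labs r' \<subseteq> C"
  by (induction rule: run.induct) auto

lemma run_append: "run u r r' tr C \<Longrightarrow> run v r' r'' tr' C' \<Longrightarrow>
    run (u @ v) r r'' (tr @ tr') (C \<union> C')"
proof (induction rule: run.induct)
  case (Nil r)
  then have "labs r \<union> C' = C'" using run_labs by blast
  with Nil show ?case by simp
next
  case (Cons t r r' tr w r'' tr'' C)
  from run.Cons[OF Cons.hyps(1) Cons.IH[OF Cons.prems]] show ?case
    by (simp add: Un_assoc)
qed

lemma run_appendE:
  assumes "run (u @ v) r r'' tr C"
  obtains r' tr1 tr2 C1 C2 where "run u r r' tr1 C1" "run v r' r'' tr2 C2"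
    "tr = tr1 @ tr2" "C = C1 \<union> C2"
proof -
  have "\<exists>r' tr1 tr2 C1 C2. run u r r' tr1 C1 \<and> run v r' r'' tr2 C2 \<and> tr = tr1 @ tr2 \<and> C = C1 \<union> C2"
    using assms
  proof (induction u arbitrary: r tr C)
    case Nil
    then have "labs r \<union> C = C" using run_labs by fastforce
    with Nil show ?case by (metis append_Nil run.Nil)
  next
    case (Cons t u)
    then obtain r0 tr0 tr0' C0 where
      *: "lstep t r r0 tr0" "run (u @ v) r0 r'' tr0' C0" "tr = tr0 @ tr0'" "C = labs r \<union> C0"
      by (auto simp: run_Cons)
    from Cons.IH[OF *(2)] obtain r' tr1 tr2 C1 C2 where
      "run u r0 r' tr1 C1" "run v r' r'' tr2 C2" "tr0' = tr1 @ tr2" "C0 = C1 \<union> C2" by blast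
    then show ?case using run.Cons[OF *(1)] * by (metis append_assoc sup_assoc)
  qed
  then show thesis using that by blast
qed

lemma lstep_frame:
  assumes "lstep t r r' tr"
  shows "lstep (shift_step (length a) t) (a @ r @ b) (a @ r' @ b) tr"
proof -
  obtain a0 b0 p p' where "r = a0 @ p @ b0" "r' = a0 @ p' @ b0" "length a0 = pos t" "piece t p p' tr"
    using assms unfolding lstep_def by blast
  then show ?thesis unfolding lstep_def
    by (intro exI[of _ "a @ a0"] exI[of _ "b0 @ b"] exI[of _ p] exI[of _ p']) simp
qed

lemma run_frame: "run w r r' tr C \<Longrightarrow>
  run (map (shift_step (length a)) w) (a @ r @ b) (a @ r' @ b) tr (labs a \<union> labs b \<union> C)"
proof (induction rule: run.induct)
  case (Nil r)
  have "labs (a @ r @ b) = labs a \<union> labs b \<union> labs r" by auto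
  then show ?case using run.Nil by (metis list.map(1))
next
  case (Cons t r r' tr w r'' tr' C)
  from run.Cons[OF lstep_frame[OF Cons.hyps(1), of a b] Cons.IH] show ?case
    by (simp add: Un_ac)
qed

lemma lstep_frameE:
  assumes "lstep (shift_step (length a) t) (a @ r @ b) r2 tr" "pos t + ins t \<le> length r"
  obtains r' where "r2 = a @ r' @ b" "lstep t r r' tr"
proof -
  have le: "ins t \<le> length r - pos t" using assms(2) by simp
  obtain p' where "piece t (take (ins t) (drop (pos t) r)) p' tr"
    "r2 = a @ take (pos t) r @ p' @ drop (pos t + ins t) r @ b"
    using assms le unfolding lstep_iff by auto
  then show thesis using assms(2) by (intro that) (auto simp: lstep_iff)
qed

text \<open>The converse of \<open>run_frame\<close> needs the width:
  \<open>tangle (length r) w m\<close> keeps every piece of \<open>w\<close> off the strands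
  \<open>b\<close>, so only the part \<open>r\<close> can change.\<close>

lemma run_frameE:
  assumes "run (map (shift_step (length a)) w) (a @ r @ b) r2 tr C" "tangle (length r) w m"
  obtains r' C' where "r2 = a @ r' @ b" "run w r r' tr C'" "C = labs a \<union> labs b \<union> C'"
proof -
  have "\<exists>r' C'. r2 = a @ r' @ b \<and> run w r r' tr C' \<and> C = labs a \<union> labs b \<union> C'"
    using assms
  proof (induction w arbitrary: r tr C)
    case Nil
    then have "r2 = a @ r @ b" "tr = []" "C = labs a \<union> labs b \<union> labs r"
      by (auto simp: run_Nil)
    then show ?case using run.Nil by blast
  next
    case (Cons t w)
    then obtain r0 tr0 tr0' C0 where
      *: "lstep (shift_step (length a) t) (a @ r @ b) r0 tr0"
      "run (map (shift_step (length a)) w) r0 r2 tr0' C0" "tr = tr0 @ tr0'"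
      "C = labs (a @ r @ b) \<union> C0"
      by (auto simp: run_Cons)
    obtain r1 where r1: "r0 = a @ r1 @ b" "lstep t r r1 tr0"
      using lstep_frameE[OF *(1)] Cons.prems(2) by auto
    with Cons.prems(2) have "tangle (length r1) w m" by (auto dest: lstep_length)
    from Cons.IH[OF *(2)[unfolded r1(1)] this] obtain r' C' where
      "r2 = a @ r' @ b" "run w r1 r' tr0' C'" "C0 = labs a \<union> labs b \<union> C'" by blast
    moreover from run.Cons[OF r1(2) this(2)] have "run (t # w) r r' tr (labs r \<union> C')"
      using * by simp
    ultimately show ?case using *(4) by (intro exI[of _ r'] exI[of _ "labs r \<union> C'"]) auto
  qed
  then show thesis using that by blast
qed

text \<open>One half of the invariance under a move. End rows and label set stay fixed, so that the
  move can be embedded in a larger diagram; of the trace only the total survives.\<close>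

definition run_le :: "slope step list \<Rightarrow> slope step list \<Rightarrow> 'l list \<Rightarrow> bool" where
  "run_le l l' r \<longleftrightarrow> (\<forall>r' tr C. run l r r' tr C \<longrightarrow> (\<exists>tr'. run l' r r' tr' C \<and> total tr' = total tr))"

lemma run_le_frame:
  assumes "run_le l l' r" "tangle (length r) l m"
  shows "run_le (map (shift_step (length a)) l) (map (shift_step (length a)) l') (a @ r @ b)"
  unfolding run_le_def
proof (intro allI impI)
  fix r2 tr C
  assume "run (map (shift_step (length a)) l) (a @ r @ b) r2 tr C"
  then obtain r' C' where *: "r2 = a @ r' @ b" "run l r r' tr C'" "C = labs a \<union> labs b \<union> C'"
    using run_frameE assms(2) by metis
  then obtain tr' where "run l' r r' tr' C'" "total tr' = total tr"
    using assms(1) unfolding run_le_def by blast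
  then show "\<exists>tr'. run (map (shift_step (length a)) l') (a @ r @ b) r2 tr' C \<and> total tr' = total tr"
    using run_frame * by metis
qed

lemma run_le_shift:
  assumes "tangle n l m" "i + n \<le> length R" "\<And>r. length r = n \<Longrightarrow> run_le l l' r"
  shows "run_le (map (shift_step i) l) (map (shift_step i) l') R"
proof -
  define a r b where "a = take i R" and "r = take n (drop i R)" and "b = drop (i + n) R"
  have R: "R = a @ r @ b"
    unfolding a_def r_def b_def by (metis add.commute append_take_drop_id drop_drop)
  have "length a = i" "length r = n" using assms(2) by (auto simp: a_def r_def)
  with run_le_frame[of l l' r m a b] assms R show ?thesis by simp
qed

lemma lstep_local: 
  "lstep (Cap 0) r r' tr \<longleftrightarrow> (\<exists>x. r' = x # bar x # r) \<and> tr = []"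
  "lstep (Cap (Suc 0)) (x # r) r' tr \<longleftrightarrow> (\<exists>z. r' = x # z # bar z # r) \<and> tr = []"
  "lstep (Cup 0) (x # y # r) r' tr \<longleftrightarrow> y = bar x \<and> r' = r \<and> tr = []"
  "lstep (Cup (Suc 0)) (x # y # z # r) r' tr \<longleftrightarrow> z = bar y \<and> r' = x # r \<and> tr = []"
  "lstep (Cup 2) (x # y # z # w # r) r' tr \<longleftrightarrow> w = bar z \<and> r' = x # y # r \<and> tr = []"
  "lstep (Cap 2) (x # y # r) r' tr \<longleftrightarrow> (\<exists>z. r' = x # y # z # bar z # r) \<and> tr = []"
  "lstep (Cross 0 c) (x # y # r) r' tr \<longleftrightarrow> r' = y # x # r \<and> tr = [(c, B x y)]"
  "lstep (Cross (Suc 0) c) (x # y # z # r) r' tr \<longleftrightarrow> r' = x # z # y # r \<and> tr = [(c, B y z)]"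
  "lstep (Cross 2 c) (x # y # z # w # r) r' tr \<longleftrightarrow> r' = x # y # w # z # r \<and> tr = [(c, B z w)]"
  by (auto simp: lstep_iff piece_simps numeral_2_eq_2)

end

text \<open>All moves except \<open>exchange\<close>, at the leftmost position. The third Reidemeister move appears
  without its condition on the slopes, which the linking number does not need.\<close>

inductive local_move :: "nat \<Rightarrow> nat \<Rightarrow> slope step list \<Rightarrow> slope step list \<Rightarrow> bool" where
  "local_move 1 1 [Cap 0, Cup (Suc 0)] []"
| "local_move 1 1 [Cap (Suc 0), Cup 0] []"
| "local_move 1 3 [Cap 0, Cross (Suc 0) x] [Cap (Suc 0), Cross 0 (flip x)]"
| "local_move 3 1 [Cross (Suc 0) x, Cup 0] [Cross 0 (flip x), Cup (Suc 0)]"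
| "local_move 0 2 [Cap 0, Cross 0 x] [Cap 0]"
| "local_move 2 0 [Cross 0 x, Cup 0] [Cup 0]"
| "local_move 2 2 [Cross 0 x, Cross 0 (flip x)] []"
| "local_move 3 3 [Cross 0 x, Cross (Suc 0) y, Cross 0 z] [Cross (Suc 0) z, Cross 0 y, Cross (Suc 0) x]"

text \<open>Every move except the exchange is a translate of a leftmost one, so its invariance can
  be checked on explicit rows of at most three labels.\<close>

lemma move_cases:
  assumes "isotopy_move l l' \<or> reidemeister_move l l'"
  obtains (exchange) s t where "pos s \<le> pos t" "l = [s, shift_step (outs s) t]" "l' = [shift_step (ins s) t, s]"
  | (local) i n m l0 l0' where "local_move n m l0 l0'" "l = map (shift_step i) l0" "l' = map (shift_step i) l0'"
proof -
  have loc: "(\<exists>s t. pos s \<le> pos t \<and> l = [s, shift_step (outs s) t] \<and> l' = [shift_step (ins s) t, s]) \<or>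
     (\<exists>i n m l0 l0'. local_move n m l0 l0' \<and> l = map (shift_step i) l0 \<and> l' = map (shift_step i) l0')" (is ?G) if "local_move n m l0 l0'" "l = map (shift_step i) l0" "l' = map (shift_step i) l0'"
    for i n m l0 l0' using that by blast
  have ?G
    using assms
  proof (elim disjE, goal_cases)
    case 1
    then show ?case
    proof cases
      case exchange then show ?thesis by blast
    next
      case (zigzag_left i)
      then show ?thesis by (intro loc[OF local_move.intros(1), of i]) simp_all
    next
      case (zigzag_right i)
      then show ?thesis by (intro loc[OF local_move.intros(2), of i]) simp_all
    next
      case (slide_cap i x)
      then show ?thesis by (intro loc[OF local_move.intros(3), of i]) simp_all
    next
      case (slide_cup i x)
      then show ?thesis by (intro loc[OF local_move.intros(4), of i]) simp_all
    qed
  next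
    case 2
    then show ?case
    proof cases
      case (R1_cap i x)
      then show ?thesis by (intro loc[OF local_move.intros(5), of i]) simp_all
    next
      case (R1_cup i x)
      then show ?thesis by (intro loc[OF local_move.intros(6), of i]) simp_all
    next
      case (R2 i x)
      then show ?thesis by (intro loc[OF local_move.intros(7), of i]) simp_all
    next
      case (R3 x y z i)
      then show ?thesis by (intro loc[OF local_move.intros(8), of i]) simp_all
    qed
  qed
  then show thesis using that by blast
qed

lemma local_move_tangle: "local_move n m l l' \<Longrightarrow> tangle n l m \<and> tangle n l' m"
  by (auto elim!: local_move.cases)

lemma append_eq_append_length:
  assumes "a @ b = c @ d" "length a \<le> length c"
  obtains m where "c = a @ m" "b = m @ d"
  using assms by (auto simp: append_eq_append_conv_if)
   (metis append_take_drop_id)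

text \<open>Widths can also be recovered from the bottom upwards: a step needs at least
  \<open>ins t\<close> strands above it, so the truncated subtraction loses nothing.\<close>

lemma tangle_unique_top: "tangle n w m \<Longrightarrow> tangle n' w m \<Longrightarrow> n = n'"
proof (induction w arbitrary: n n')
  case (Cons t w)
  then have "n - ins t + outs t = n' - ins t + outs t" by auto
  then show ?case using Cons.prems by auto
qed simp

section \<open>Invariance of runs under the moves\<close>

context labelling
begin

lemma run_Cons': "run (t # w) r r'' tr C \<longleftrightarrow> (\<exists>r' tr0. lstep t r r' tr0 \<and>
  (\<exists>tr1 C1. run w r' r'' tr1 C1 \<and> tr = tr0 @ tr1 \<and> C = labs r \<union> C1))"
  by (auto simp: run_Cons)

lemma ex_image: "(\<exists>r. (\<exists>x. r = f x) \<and> P r) \<longleftrightarrow> (\<exists>x. P (f x))"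
  by blast

lemmas run_simps = run_Cons' run_Nil lstep_local ex_image

lemma lstepI: "piece t p p' tr \<Longrightarrow> length a = pos t \<Longrightarrow> lstep t (a @ p @ b) (a @ p' @ b) tr"
  unfolding lstep_def by blast

text \<open>As \<open>t\<close> lies to the right of \<open>s\<close>, the upper row splits as
  \<open>a @ p @ m @ q @ e\<close>, where \<open>s\<close> acts on \<open>p\<close>,
  \<open>t\<close> acts on \<open>q\<close> and \<open>m\<close> lies in between. The pieces do not
  interact; only the order of the trace changes.\<close>

lemma run_le_exchange:
  assumes "pos s \<le> pos t"
  shows "run_le [s, shift_step (outs s) t] [shift_step (ins s) t, s] R"
    and "run_le [shift_step (ins s) t, s] [s, shift_step (outs s) t] R"
proof -
  show "run_le [s, shift_step (outs s) t] [shift_step (ins s) t, s] R"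
    unfolding run_le_def
  proof (intro allI impI)
    fix R2 tr C
    assume "run [s, shift_step (outs s) t] R R2 tr C"
    then obtain R1 tr1 tr2 where *: "lstep s R R1 tr1" "lstep (shift_step (outs s) t) R1 R2 tr2"
      "tr = tr1 @ tr2" "C = labs R \<union> (labs R1 \<union> labs R2)"
      by (auto simp: run_simps)
    obtain a p p' b where s: "R = a @ p @ b" "R1 = a @ p' @ b" "length a = pos s" "piece s p p' tr1"
      using *(1) unfolding lstep_def by blast
    obtain c q q' e where t: "R1 = c @ q @ e" "R2 = c @ q' @ e" "length c = outs s + pos t" "piece t q q' tr2"
      using *(2) unfolding lstep_def by (simp add: add.commute) blast
    have len: "length (a @ p') \<le> length c"
      using assms s t piece_lengths[OF s(4)] by simp
    have "(a @ p') @ b = c @ (q @ e)" using s t by simp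
    then obtain m where m: "c = (a @ p') @ m" "b = m @ (q @ e)"
      by (rule append_eq_append_length[OF _ len])
    have l: "length (a @ p @ m) = ins s + pos t"
      using m t s piece_lengths[OF s(4)] by simp
    have R: "R = (a @ p @ m) @ q @ e" "R2 = a @ p' @ m @ q' @ e"
      using s(1) t(2) m by simp_all
    have "lstep (shift_step (ins s) t) ((a @ p @ m) @ q @ e) ((a @ p @ m) @ q' @ e) tr2"
      using l t(4) by (intro lstepI) auto
    from run.Cons[OF this[unfolded append_assoc] run.Cons[OF lstepI[OF s(4,3)] run.Nil]]
    have "run [shift_step (ins s) t, s] R R2 (tr2 @ tr1) (labs R \<union> (labs (a @ p @ m @ q' @ e) \<union> labs R2))"
      unfolding R by (simp add: Un_assoc)
    \<comment> \<open>Every label of either intermediate row already occurs in \<open>R\<close> or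
      in \<open>R2\<close>, so the label sets agree although the intermediate rows differ.\<close>
    moreover have "labs R \<union> (labs (a @ p @ m @ q' @ e) \<union> labs R2) = C"
      using * s t m by auto
    ultimately show "\<exists>tr'. run [shift_step (ins s) t, s] R R2 tr' C \<and> total tr' = total tr"
      using * by (intro exI[of _ "tr2 @ tr1"]) simp
  qed
next
  show "run_le [shift_step (ins s) t, s] [s, shift_step (outs s) t] R"
    unfolding run_le_def
  proof (intro allI impI)
    fix R2 tr C
    assume "run [shift_step (ins s) t, s] R R2 tr C"
    then obtain R1 tr1 tr2 where *: "lstep (shift_step (ins s) t) R R1 tr2" "lstep s R1 R2 tr1"
      "tr = tr2 @ tr1" "C = labs R \<union> (labs R1 \<union> labs R2)"
      by (auto simp: run_simps)
    obtain a p p' b where s: "R1 = a @ p @ b" "R2 = a @ p' @ b" "length a = pos s" "piece s p p' tr1"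
      using *(2) unfolding lstep_def by blast
    obtain c q q' e where t: "R = c @ q @ e" "R1 = c @ q' @ e" "length c = ins s + pos t" "piece t q q' tr2"
      using *(1) unfolding lstep_def by (simp add: add.commute) blast
    have len: "length (a @ p) \<le> length c"
      using assms s t piece_lengths[OF s(4)] by simp
    have "(a @ p) @ b = c @ (q' @ e)" using s t by simp
    then obtain m where m: "c = (a @ p) @ m" "b = m @ (q' @ e)"
      by (rule append_eq_append_length[OF _ len])
    have l: "length (a @ p' @ m) = outs s + pos t"
      using m t s piece_lengths[OF s(4)] by simp
    have R: "R = a @ p @ m @ q @ e" "R2 = (a @ p' @ m) @ q' @ e"
      using s(2) t(1) m by simp_all
    have "lstep (shift_step (outs s) t) ((a @ p' @ m) @ q @ e) ((a @ p' @ m) @ q' @ e) tr2"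
      using l t(4) by (intro lstepI) auto
    from run.Cons[OF lstepI[OF s(4,3)] run.Cons[OF this[unfolded append_assoc] run.Nil]]
    have "run [s, shift_step (outs s) t] R R2 (tr1 @ tr2) (labs R \<union> (labs (a @ p' @ m @ q @ e) \<union> labs R2))"
      unfolding R by (simp add: Un_assoc)
    moreover have "labs R \<union> (labs (a @ p' @ m @ q @ e) \<union> labs R2) = C"
      using * s t m by auto
    ultimately show "\<exists>tr'. run [s, shift_step (outs s) t] R R2 tr' C \<and> total tr' = total tr"
      using * by (intro exI[of _ "tr1 @ tr2"]) simp
  qed
qed

end

text \<open>A slide flips the slope and reverses one of the two labels at its crossing, so the total
  can survive it only because \<open>B\<close> changes sign under \<open>bar\<close>.\<close>

locale oriented_labelling = labelling bar B "-1" for bar :: "'l \<Rightarrow> 'l" and B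
begin

text \<open>Besides the slides: at an R1 crossing a label meets its own \<open>bar\<close>, with
  value 0; the two crossings of R2 have equal values and opposite slopes; on both sides of R3 each
  pair of strands meets once, with the same slope.\<close>

lemma run_le_local_move:
  assumes "local_move n m l l'" "length r = n"
  shows "run_le l l' r \<and> run_le l' l r"
proof -
  have lens: "length r = 1 \<Longrightarrow> \<exists>x. r = [x]" "length r = 2 \<Longrightarrow> \<exists>x y. r = [x, y]"
    "length r = 3 \<Longrightarrow> \<exists>x y z. r = [x, y, z]"
    by (auto simp: numeral_3_eq_3 numeral_2_eq_2 length_Suc_conv)
  note evs = run_le_def run_simps B_bar B_bar_right
  show ?thesis
    using assms
  proof cases
    case 1
    with assms obtain x where "r = [x]" using lens by blast
    with 1 show ?thesis by (auto simp: evs)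
  next
    case 2
    with assms obtain x where "r = [x]" using lens by blast
    with 2 show ?thesis by (auto simp: evs)
  next
    case 3
    with assms obtain x where "r = [x]" using lens by blast
    with 3 show ?thesis by (auto simp: evs; metis B_sym)
  next
    case 4
    with assms obtain x y z where "r = [x, y, z]" using lens by blast
    with 4 show ?thesis by (auto simp: evs; metis B_sym)
  next
    case 5
    with assms show ?thesis by (auto simp: evs)
  next
    case 6
    with assms obtain x y where "r = [x, y]" using lens by blast
    with 6 show ?thesis by (auto simp: evs)
  next
    case 7
    with assms obtain x y where "r = [x, y]" using lens by blast
    with 7 show ?thesis by (auto simp: evs; metis B_sym)
  next
    case 8
    with assms obtain x y z where "r = [x, y, z]" using lens by blast
    with 8 show ?thesis by (auto simp: evs)
  qed
qed

lemma run_le_move: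
  assumes "isotopy_move l l' \<or> reidemeister_move l l'"
    and "tangle (length r) l m" "tangle (length r) l' m"
  shows "run_le l l' r \<and> run_le l' l r"
  using assms(1)
proof (cases rule: move_cases)
  case (exchange s t)
  then show ?thesis using run_le_exchange by blast
next
  case (local i n m' l0 l0')
  have "i + n \<le> length r"
    using local assms(2,3) by (auto elim!: local_move.cases)
  moreover have "run_le l0 l0' r \<and> run_le l0' l0 r" if "length r = n" for r
    using run_le_local_move[OF local(1) that] .
  ultimately show ?thesis
    using run_le_shift[of n l0 m' i r l0'] run_le_shift[of n l0' m' i r l0] local
      local_move_tangle[OF local(1)] by simp
qed

lemma run_diagram_step:
  assumes "diagram_step D D' \<or> diagram_step D' D" "run D [] [] tr C"
  shows "\<exists>tr'. run D' [] [] tr' C \<and> total tr' = total tr"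
proof -
  obtain u l l' v where D: "D = u @ l @ v" "D' = u @ l' @ v" "closed D" "closed D'"
    and move: "(isotopy_move l l' \<or> reidemeister_move l l') \<or> (isotopy_move l' l \<or> reidemeister_move l' l)"
    using assms(1) unfolding diagram_step.simps by (elim disjE exE conjE) blast+
  obtain r tr1 tr4 C1 C4 where
    r: "run u [] r tr1 C1" "run (l @ v) r [] tr4 C4" "tr = tr1 @ tr4" "C = C1 \<union> C4"
    by (rule run_appendE[OF assms(2)[unfolded D(1)]])
  obtain r' tr2 tr3 C2 C3 where
    r': "run l r r' tr2 C2" "run v r' [] tr3 C3" "tr4 = tr2 @ tr3" "C4 = C2 \<union> C3"
    by (rule run_appendE[OF r(2)])
  have "tangle 0 (u @ l' @ v) 0" using D by (simp add: closed_def)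
  then obtain n m where nm: "tangle 0 u n" "tangle n l' m" "tangle m v 0"
    unfolding tangle_append_iff by blast
  \<comment> \<open>The width above the move is determined from the top by \<open>u\<close>, the
    width below it from the bottom by \<open>v\<close>.\<close>
  have "n = length r" using tangle_unique[OF nm(1)] run_tangle[OF r(1)] by simp
  moreover have "m = length r'" using tangle_unique_top[OF nm(3)] run_tangle[OF r'(2)] by simp
  ultimately have "run_le l l' r"
    using move run_le_move nm(2) run_tangle[OF r'(1)] by blast
  then obtain tr2' where "run l' r r' tr2' C2" "total tr2' = total tr2"
    using r' unfolding run_le_def by blast
  moreover from run_append[OF r(1) run_append[OF this(1) r'(2)]]
  have "run D' [] [] (tr1 @ tr2' @ tr3) C" using r r' D by simp
  ultimately show ?thesis using r r' by (intro exI[of _ "tr1 @ tr2' @ tr3"]) simp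
qed

lemma run_equivalent:
  assumes "equivalent D D'" "run D [] [] tr C"
  shows "\<exists>tr'. run D' [] [] tr' C \<and> total tr' = total tr"
  using assms(1) unfolding equivalent_def
proof (induction rule: equivclp_induct)
  case base
  then show ?case using assms(2) by blast
next
  case (step y z)
  then show ?case using run_diagram_step by metis
qed

end

section \<open>Equivalence of tangles\<close>

text \<open>The analogue of \<open>diagram_step\<close> with fixed endpoints, so that a tangle can
  be simplified before further twists and the closing arcs are added.\<close>

definition tangle_step :: "nat \<Rightarrow> nat \<Rightarrow> slope step list \<Rightarrow> slope step list \<Rightarrow> bool" where
  "tangle_step n m w w' \<longleftrightarrow> (\<exists>u l l' v. w = u @ l @ v \<and> w' = u @ l' @ v \<and>
    (isotopy_move l l' \<or> reidemeister_move l l') \<and> tangle n w m \<and> tangle n w' m)"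

lemma tangle_stepI:
  "isotopy_move l l' \<or> reidemeister_move l l' \<Longrightarrow> tangle n (u @ l @ v) m \<Longrightarrow> tangle n (u @ l' @ v) m \<Longrightarrow>
    tangle_step n m (u @ l @ v) (u @ l' @ v)"
  unfolding tangle_step_def by blast

definition tangle_equiv :: "nat \<Rightarrow> nat \<Rightarrow> slope step list \<Rightarrow> slope step list \<Rightarrow> bool" where
  "tangle_equiv n m = equivclp (tangle_step n m)"

lemma tangle_equiv_refl [simp]: "tangle_equiv n m w w"
  by (simp add: tangle_equiv_def)

lemma tangle_equiv_trans [trans]:
  "tangle_equiv n m w w' \<Longrightarrow> tangle_equiv n m w' w'' \<Longrightarrow> tangle_equiv n m w w''"
  unfolding tangle_equiv_def by (rule equivclp_trans)

lemma tangle_equiv_map: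
  assumes "tangle_equiv n m w w'"
    and "\<And>w w'. tangle_step n m w w' \<Longrightarrow> tangle_step n' m' (f w) (f w')"
  shows "tangle_equiv n' m' (f w) (f w')"
  using assms(1) unfolding tangle_equiv_def
proof (induction rule: equivclp_induct)
  case (step y z)
  then show ?case using assms(2) by (meson equivclp_into_equivclp)
qed simp

lemma tangle_equiv_context:
  assumes "tangle_equiv n m w w'" "tangle n' u n" "tangle m v m'"
  shows "tangle_equiv n' m' (u @ w @ v) (u @ w' @ v)"
proof (rule tangle_equiv_map[OF assms(1)])
  fix w w'
  assume "tangle_step n m w w'"
  then obtain a l l' b where "w = a @ l @ b" "w' = a @ l' @ b"
    "isotopy_move l l' \<or> reidemeister_move l l'" "tangle n w m" "tangle n w' m"
    unfolding tangle_step_def by blast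
  then show "tangle_step n' m' (u @ w @ v) (u @ w' @ v)"
    unfolding tangle_step_def using assms(2,3)
    by (intro exI[of _ "u @ a"] exI[of _ l] exI[of _ l'] exI[of _ "b @ v"])
       (auto simp: tangle_append_iff)
qed

lemma tangle_equiv_strands_right:
  "tangle_equiv n m w w' \<Longrightarrow> tangle_equiv (n + k) (m + k) w w'"
proof (rule tangle_equiv_map[of n m w w' _ _ "\<lambda>w. w"])
  show "tangle_step (n + k) (m + k) w w'" if "tangle_step n m w w'" for w w'
    using that tangle_strands_right unfolding tangle_step_def by blast
qed

lemma move_shift:
  assumes "isotopy_move l l' \<or> reidemeister_move l l'"
  shows "isotopy_move (map (shift_step k) l) (map (shift_step k) l') \<or>
    reidemeister_move (map (shift_step k) l) (map (shift_step k) l')"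
  using assms
proof (elim disjE, goal_cases)
  case 1
  then show ?case
  proof cases
    case (exchange s t)
    with isotopy_move.exchange[of "shift_step k s" "shift_step k t"] show ?thesis
      by (simp add: shift_step_add add.commute)
  qed (auto intro: isotopy_move.intros)
next
  case 2
  then show ?case by cases (auto intro: reidemeister_move.intros)
qed

lemma tangle_equiv_strands_left:
  "tangle_equiv n m w w' \<Longrightarrow> tangle_equiv (k + n) (k + m) (map (shift_step k) w) (map (shift_step k) w')"
proof (rule tangle_equiv_map[of n m w w'])
  fix w w'
  assume "tangle_step n m w w'"
  then obtain a l l' b where "w = a @ l @ b" "w' = a @ l' @ b"
    "isotopy_move l l' \<or> reidemeister_move l l'" "tangle n w m" "tangle n w' m"
    unfolding tangle_step_def by blast
  then show "tangle_step (k + n) (k + m) (map (shift_step k) w) (map (shift_step k) w')"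
    using tangle_stepI[OF move_shift[of l l' k]] tangle_strands_left[of n w m k]
      tangle_strands_left[of n w' m k] by simp
qed

lemma equivalent_if_tangle_equiv:
  assumes "tangle_equiv 0 0 w w'"
  shows "equivalent w w'"
proof -
  have "tangle_step 0 0 w w' \<Longrightarrow> diagram_step w w'" for w w'
    unfolding tangle_step_def using diagram_step.intros unfolding closed_def by blast
  show ?thesis
    using assms unfolding tangle_equiv_def equivalent_def
  proof (induction rule: equivclp_induct)
    case (step y z)
    then show ?case using \<open>\<And>w w'. tangle_step 0 0 w w' \<Longrightarrow> diagram_step w w'\<close>
      by (meson equivclp_into_equivclp)
  qed simp
qed

lemma tangle_equiv_move:
  assumes "isotopy_move l l' \<or> reidemeister_move l l'" "tangle n (u @ l @ v) m" "tangle n (u @ l' @ v) m"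
  shows "tangle_equiv n m (u @ l @ v) (u @ l' @ v)" "tangle_equiv n m (u @ l' @ v) (u @ l @ v)"
proof -
  have "tangle_step n m (u @ l @ v) (u @ l' @ v)"
    unfolding tangle_step_def using assms by blast
  then show "tangle_equiv n m (u @ l @ v) (u @ l' @ v)" "tangle_equiv n m (u @ l' @ v) (u @ l @ v)"
    unfolding tangle_equiv_def by (auto intro: equivclp_sym)
qed

lemma flip_flip [simp]: "flip (flip x) = x"
  by (cases x) auto

section \<open>Effect of one twist on the simplest tangles\<close>

lemma twist_bottom_cong:
  "tangle_equiv 2 2 T T' \<Longrightarrow> tangle_equiv 2 2 (twist_bottom x T) (twist_bottom x T')"
  using tangle_equiv_context[of 2 2 T T' 2 "[]" "[Cross 0 x]" 2] by (simp add: twist_bottom_def)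

lemma twist_right_cong:
  assumes "tangle_equiv 2 2 T T'"
  shows "tangle_equiv 2 2 (twist_right x T) (twist_right x T')"
  using tangle_equiv_context[OF tangle_equiv_strands_right[OF assms, of 2], of 2 "[Cap 1]" "[Cross 2 x, Cup 1]" 2]
  by (simp add: twist_right_def)

text \<open>The new crossing is a kink in the right strand. A slide turns it so that it sits on a
  minimum, where R1 removes it and leaves a zigzag.\<close>

lemma twist_right_vert: "tangle_equiv 2 2 (twist_right x []) []"
proof -
  have "tangle_equiv 2 2 [Cap 1, Cross 2 x, Cup 1] [Cap 2, Cross 1 (flip x), Cup 1]"
    using tangle_equiv_move(1)[of "[Cap 1, Cross 2 x]" "[Cap 2, Cross 1 (flip x)]" 2 "[]" "[Cup 1]" 2]
      isotopy_move.slide_cap[of 1 x] by (simp add: numeral_2_eq_2)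
  also have "tangle_equiv 2 2 \<dots> [Cap 2, Cup 1]"
    using tangle_equiv_move(1)[of "[Cross 1 (flip x), Cup 1]" "[Cup 1]" 2 "[Cap 2]" "[]" 2]
      reidemeister_move.R1_cup[of 1 "flip x"] by (simp add: numeral_2_eq_2)
  also have "tangle_equiv 2 2 \<dots> []"
    using tangle_equiv_move(1)[of "[Cap 2, Cup 1]" "[]" 2 "[]" "[]" 2]
      isotopy_move.zigzag_right[of 1] by (simp add: numeral_2_eq_2)
  finally show ?thesis by (simp add: twist_right_def)
qed

lemma twist_bottom_hor: "tangle_equiv 2 2 (twist_bottom x [Cup 0, Cap 0]) [Cup 0, Cap 0]"
  using tangle_equiv_move(1)[of "[Cap 0, Cross 0 x]" "[Cap 0]" 2 "[Cup 0]" "[]" 2]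
    reidemeister_move.R1_cap[of 0 x] by (simp add: twist_bottom_def numeral_2_eq_2)

lemma twist_bottom_cross: "tangle_equiv 2 2 (twist_bottom (flip x) [Cross 0 x]) []"
  using tangle_equiv_move(1)[of "[Cross 0 x, Cross 0 (flip x)]" "[]" 2 "[]" "[]" 2]
    reidemeister_move.R2[of 0 x] by (simp add: twist_bottom_def numeral_2_eq_2)

text \<open>One slide each brings both crossings onto the same pair of strands between the cap and
  the cup. Both slopes are flipped, so they are still opposite and R2 applies.\<close>

lemma twist_right_cross: "tangle_equiv 2 2 (twist_right (flip x) [Cross 0 x]) [Cup 0, Cap 0]"
proof -
  have "tangle_equiv 2 2 [Cap 1, Cross 0 x, Cross 2 (flip x), Cup 1] [Cap 0, Cross 1 (flip x), Cross 2 (flip x), Cup 1]"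
    using tangle_equiv_move(2)[of "[Cap 0, Cross 1 (flip x)]" "[Cap 1, Cross 0 x]" 2 "[]" "[Cross 2 (flip x), Cup 1]" 2]
      isotopy_move.slide_cap[of 0 "flip x"] by (simp add: numeral_2_eq_2)
  also have "tangle_equiv 2 2 \<dots> [Cap 0, Cross 1 (flip x), Cross 1 x, Cup 2]"
    using tangle_equiv_move(1)[of "[Cross 2 (flip x), Cup 1]" "[Cross 1 x, Cup 2]" 2 "[Cap 0, Cross 1 (flip x)]" "[]" 2]
      isotopy_move.slide_cup[of 1 "flip x"] by (simp add: numeral_2_eq_2)
  also have "tangle_equiv 2 2 \<dots> [Cap 0, Cup 2]"
    using tangle_equiv_move(1)[of "[Cross 1 (flip x), Cross 1 x]" "[]" 2 "[Cap 0]" "[Cup 2]" 2]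
      reidemeister_move.R2[of 1 "flip x"] by (simp add: numeral_2_eq_2)
  also have "tangle_equiv 2 2 \<dots> [Cup 0, Cap 0]"
    using tangle_equiv_move(1)[of "[Cap 0, Cup 2]" "[Cup 0, Cap 0]" 2 "[]" "[]" 2]
      isotopy_move.exchange[of "Cap 0" "Cup 0"] by (simp add: numeral_2_eq_2)
  finally show ?thesis by (simp add: twist_right_def)
qed

text \<open>A single crossing is at once a bottom twist of the vertical tangle and a right twist of
  the horizontal one, with the same slope. So the crosswise type need not remember how it was
  entered.\<close>

lemma twist_right_hor: "tangle_equiv 2 2 (twist_right x [Cup 0, Cap 0]) [Cross 0 x]"
proof -
  have "tangle_equiv 2 2 [Cap 1, Cup 0, Cap 0, Cross 2 x, Cup 1] [Cap 0, Cross 2 x, Cup 1]"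
    using tangle_equiv_move(1)[of "[Cap 1, Cup 0]" "[]" 2 "[]" "[Cap 0, Cross 2 x, Cup 1]" 2]
      isotopy_move.zigzag_right[of 0] by (simp add: numeral_2_eq_2)
  also have "tangle_equiv 2 2 \<dots> [Cross 0 x, Cap 0, Cup 1]"
    using tangle_equiv_move(1)[of "[Cap 0, Cross 2 x]" "[Cross 0 x, Cap 0]" 2 "[]" "[Cup 1]" 2]
      isotopy_move.exchange[of "Cap 0" "Cross 0 x"] by (simp add: numeral_2_eq_2)
  also have "tangle_equiv 2 2 \<dots> [Cross 0 x]"
    using tangle_equiv_move(1)[of "[Cap 0, Cup 1]" "[]" 2 "[Cross 0 x]" "[]" 2]
      isotopy_move.zigzag_left[of 0] by (simp add: numeral_2_eq_2)
  finally show ?thesis by (simp add: twist_right_def)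
qed

section \<open>Rational tangles, crossing by crossing\<close>

datatype connection = Vert | Cro | Hor

fun turn :: "bool \<Rightarrow> connection \<Rightarrow> connection" where
  "turn True Vert = Cro"
| "turn True Cro = Vert"
| "turn True Hor = Hor"
| "turn False Vert = Vert"
| "turn False Cro = Hor"
| "turn False Hor = Cro"

fun twist :: "bool \<Rightarrow> 'x \<Rightarrow> 'x step list \<Rightarrow> 'x step list" where
  "twist True x T = T @ [Cross 0 x]"
| "twist False x T = Cap 1 # T @ [Cross 2 x, Cup 1]"

text \<open>A rational tangle is given by a list of twists, \<open>True\<close> standing for a bottom twist and \<open>False\<close>
  for a right twist. The crossing labels are arbitrary, so that they can also serve as names of the
  crossings.\<close>

definition build :: "(bool \<times> 'x) list \<Rightarrow> 'x step list" where
  "build ls = foldl (\<lambda>T (b, x). twist b x T) [] ls"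

definition connect :: "connection \<Rightarrow> (bool \<times> 'x) list \<Rightarrow> connection" where
  "connect s ls = foldl (\<lambda>s (b, x). turn b s) s ls"

lemma build_simps [simp]: "build [] = []" "build (ls @ [(b, x)]) = twist b x (build ls)"
  by (simp_all add: build_def)

lemma connect_simps [simp]: "connect s [] = s" "connect s ((b, x) # ls) = connect (turn b s) ls"
  "connect s (ls @ [(b, x)]) = turn b (connect s ls)"
  by (simp_all add: connect_def)

fun selfs :: "connection \<Rightarrow> (bool \<times> 'x) list \<Rightarrow> 'x list" where
  "selfs s [] = []"
| "selfs s ((b, x) # ls) = (if turn b s = s then [x] else []) @ selfs (turn b s) ls"

fun mutuals :: "connection \<Rightarrow> (bool \<times> 'x) list \<Rightarrow> 'x list" where
  "mutuals s [] = []"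
| "mutuals s ((b, x) # ls) = (if turn b s = s then [] else [x]) @ mutuals (turn b s) ls"

text \<open>Up to a common factor, the values of \<open>B\<close> at the crossings. A self-intersection reverses one of
  the two strands at the ends of the tangle, hence the factor \<open>\<sigma>\<close> for each later one.\<close>

fun weights :: "int \<Rightarrow> connection \<Rightarrow> (bool \<times> 'x) list \<Rightarrow> int list" where
  "weights \<sigma> s [] = []"
| "weights \<sigma> s ((b, x) # ls) =
    (if turn b s = s then 0 else \<sigma> ^ length (selfs (turn b s) ls)) # weights \<sigma> (turn b s) ls"

lemma length_weights [simp]: "length (weights \<sigma> s ls) = length ls"
  by (induction \<sigma> s ls rule: weights.induct) auto

lemma selfs_snoc: "selfs s (ls @ [(b, x)]) =
    selfs s ls @ (if turn b (connect s ls) = connect s ls then [x] else [])"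
  by (induction s ls rule: selfs.induct) auto

text \<open>\<open>build\<close> grows at the right end of the list, whereas \<open>weights\<close>
  recurses from the left. An appended self-intersection comes later than all other crossings and
  multiplies their weights by \<open>\<sigma>\<close>.\<close>

lemma weights_snoc: "weights \<sigma> s (ls @ [(b, x)]) =
   (if turn b (connect s ls) = connect s ls then map ((*) \<sigma>) (weights \<sigma> s ls) @ [0]
    else weights \<sigma> s ls @ [1])"
  by (induction s ls rule: selfs.induct) (auto simp: selfs_snoc)

lemma tangle_build: "tangle 2 (build ls) 2"
proof (induction ls rule: rev_induct)
  case (snoc l ls)
  obtain b x where l: "l = (b, x)" by fastforce
  show ?case
  proof (cases b)
    case True
    then show ?thesis using tangle_append[OF snoc.IH, of "[Cross 0 x]" 2] l by simp
  next
    case False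
    then show ?thesis
      using tangle_append[OF tangle_strands_right[OF snoc.IH, of 2], of "[Cross 2 x, Cup 1]" 2] l
      by simp
  qed
qed simp

lemma length_2E:
  assumes "length r = 2"
  obtains x y where "r = [x, y]"
  using assms by (auto simp: numeral_2_eq_2 length_Suc_conv)

section \<open>Labellings of rational tangles\<close>

context labelling
begin

text \<open>The arguments are the labels at NW, NE, SW, SE. A horizontal arc turns back, hence
  \<open>bar\<close>.\<close>

fun joins :: "connection \<Rightarrow> 'l \<Rightarrow> 'l \<Rightarrow> 'l \<Rightarrow> 'l \<Rightarrow> bool" where
  "joins Vert x y z w \<longleftrightarrow> z = x \<and> w = y"
| "joins Cro x y z w \<longleftrightarrow> z = y \<and> w = x"
| "joins Hor x y z w \<longleftrightarrow> y = bar x \<and> w = bar z"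

text \<open>A label of the strand that does not contain NW: the one at NE, or the one at SW if NE
  belongs to the strand of NW.\<close>

fun other :: "connection \<Rightarrow> 'l \<Rightarrow> 'l \<Rightarrow> 'l" where
  "other Vert y z = y"
| "other Cro y z = y"
| "other Hor y z = z"

lemma run_twist_bottom:
  "run (twist True c T) [x, y] r' tr C \<longleftrightarrow> (\<exists>z w tr1 C1. run T [x, y] [w, z] tr1 C1 \<and> r' = [z, w] \<and>
    tr = tr1 @ [(c, B w z)] \<and> C = C1 \<union> labs [z, w])"
  if "tangle 2 T 2"
proof
  assume "run (twist True c T) [x, y] r' tr C"
  then have "run (T @ [Cross 0 c]) [x, y] r' tr C" by simp
  then obtain r1 tr1 tr2 C1 C2 where
    1: "run T [x, y] r1 tr1 C1" "run [Cross 0 c] r1 r' tr2 C2" "tr = tr1 @ tr2" "C = C1 \<union> C2"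
    by (rule run_appendE)
  have "length r1 = 2" using run_tangle[OF 1(1)] that tangle_unique[of 2 T "length r1" 2]
    by (simp add: numeral_2_eq_2)
  then obtain w z where "r1 = [w, z]" by (rule length_2E)
  then show "\<exists>z w tr1 C1. run T [x, y] [w, z] tr1 C1 \<and> r' = [z, w] \<and>
    tr = tr1 @ [(c, B w z)] \<and> C = C1 \<union> labs [z, w]"
    using 1 run_labs[OF 1(1)] by (auto simp: run_simps)
next
  assume "\<exists>z w tr1 C1. run T [x, y] [w, z] tr1 C1 \<and> r' = [z, w] \<and>
    tr = tr1 @ [(c, B w z)] \<and> C = C1 \<union> labs [z, w]"
  then obtain z w tr1 C1 where 1: "run T [x, y] [w, z] tr1 C1" "r' = [z, w]"
    "tr = tr1 @ [(c, B w z)]" "C = C1 \<union> labs [z, w]"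
    by blast
  have "run [Cross 0 c] [w, z] [z, w] [(c, B w z)] (labs [w, z] \<union> labs [z, w])"
    by (auto simp: run_simps)
  from run_append[OF 1(1) this] show "run (twist True c T) [x, y] r' tr C"
    using 1 run_labs[OF 1(1)] by (simp add: Un_absorb2 Un_absorb1 insert_commute)
qed

text \<open>The cap and the cup of the twist reverse labels: with \<open>y\<close> and
  \<open>w\<close> at the new NE and SE endpoints, \<open>T\<close> has \<open>bar w\<close> at its
  NE end and \<open>bar y\<close> at its SE end.\<close>

lemma run_twist_right:
  assumes "tangle 2 T 2"
  shows "run (twist False c T) [x, y] r' tr C \<longleftrightarrow> (\<exists>z w tr1 C1. run T [x, bar w] [z, bar y] tr1 C1 \<and>
    r' = [z, w] \<and> tr = tr1 @ [(c, B w y)] \<and> C = C1 \<union> labs [x, y, z, w])"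
proof
  assume "run (twist False c T) [x, y] r' tr C"
  then have "run (Cap (Suc 0) # T @ [Cross 2 c, Cup (Suc 0)]) [x, y] r' tr C" by simp
  then obtain u C0 where C0: "run (T @ [Cross 2 c, Cup (Suc 0)]) [x, u, bar u, y] r' tr C0"
    "C = labs [x, y] \<union> C0"
    unfolding run_Cons lstep_local by auto
  from C0(1) obtain r1 tr1 tr2 C1 C2 where
    1: "run T [x, u, bar u, y] r1 tr1 C1" "run [Cross 2 c, Cup (Suc 0)] r1 r' tr2 C2"
    "tr = tr1 @ tr2" "C0 = C1 \<union> C2"
    by (rule run_appendE)
  have 2: "run (map (shift_step (length [])) T) ([] @ [x, u] @ [bar u, y]) r1 tr1 C1"
    using 1(1) by simp
  obtain r0 C3 where 3: "r1 = [] @ r0 @ [bar u, y]" "run T [x, u] r0 tr1 C3"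
    "C1 = labs [] \<union> labs [bar u, y] \<union> C3"
  proof (rule run_frameE[OF 2])
    show "tangle (length [x, u]) T 2" using assms by (simp add: numeral_2_eq_2)
  qed
  have "length r0 = 2" using run_tangle[OF 3(2)] assms tangle_unique[of 2 T "length r0" 2]
    by (simp add: numeral_2_eq_2)
  then obtain z v where r0: "r0 = [z, v]" by (rule length_2E)
  from 1(2) have 4: "y = bar v" "r' = [z, bar u]" "tr2 = [(c, B (bar u) y)]"
    "C2 = labs [z, v, bar u, y] \<union> labs [z, v, y, bar u] \<union> labs [z, bar u]"
    unfolding 3(1) r0 by (auto simp: run_simps)
  have "run T [x, bar (bar u)] [z, bar y] tr1 C3" using 3(2) r0 4(1) by simp
  moreover have "C = C3 \<union> labs [x, y, z, bar u]"
    unfolding C0(2) 1(4) 3(3) 4(4) unfolding 4(1) by auto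
  ultimately show "\<exists>z w tr1 C1. run T [x, bar w] [z, bar y] tr1 C1 \<and>
    r' = [z, w] \<and> tr = tr1 @ [(c, B w y)] \<and> C = C1 \<union> labs [x, y, z, w]"
    using 1(3) 4(2,3) by blast
next
  assume "\<exists>z w tr1 C1. run T [x, bar w] [z, bar y] tr1 C1 \<and>
    r' = [z, w] \<and> tr = tr1 @ [(c, B w y)] \<and> C = C1 \<union> labs [x, y, z, w]"
  then obtain z w tr1 C1 where 1: "run T [x, bar w] [z, bar y] tr1 C1" "r' = [z, w]"
    "tr = tr1 @ [(c, B w y)]" "C = C1 \<union> labs [x, y, z, w]" by blast
  have "run T [x, bar w, w, y] [z, bar y, w, y] tr1 (labs [] \<union> labs [w, y] \<union> C1)"
    using run_frame[OF 1(1), of "[]" "[w, y]"] by simp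
  moreover have "run [Cross 2 c, Cup (Suc 0)] [z, bar y, w, y] [z, w] [(c, B w y)]
     (labs [z, bar y, w, y] \<union> (labs [z, bar y, y, w] \<union> labs [z, w]))"
    by (auto simp: run_simps)
  ultimately have "run (T @ [Cross 2 c, Cup (Suc 0)]) [x, bar w, w, y] [z, w] (tr1 @ [(c, B w y)])
    ((labs [] \<union> labs [w, y] \<union> C1) \<union> (labs [z, bar y, w, y] \<union> (labs [z, bar y, y, w] \<union> labs [z, w])))"
    by (rule run_append)
  moreover have "lstep (Cap (Suc 0)) [x, y] [x, bar w, w, y] []"
    unfolding lstep_local by (intro conjI exI[of _ "bar w"]) simp_all
  ultimately have "run (Cap (Suc 0) # T @ [Cross 2 c, Cup (Suc 0)]) [x, y] [z, w] ([] @ tr1 @ [(c, B w y)])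
    (labs [x, y] \<union> ((labs [] \<union> labs [w, y] \<union> C1) \<union> (labs [z, bar y, w, y] \<union> (labs [z, bar y, y, w] \<union> labs [z, w]))))"
    using run.Cons by blast
  moreover have "labs [x, y] \<union> ((labs [] \<union> labs [w, y] \<union> C1) \<union> (labs [z, bar y, w, y] \<union> (labs [z, bar y, y, w] \<union> labs [z, w]))) = C"
    unfolding 1(4) by auto
  ultimately show "run (twist False c T) [x, y] r' tr C"
    using 1 by simp
qed

lemma square_cancel: "\<sigma> * (\<sigma> * k) = k"
  by (metis mult.assoc mult_1 s_square)

text \<open>A twist that changes the type adds a crossing of value \<open>B x (other s y z)\<close>
  and leaves the label \<open>other\<close> as it was. A self-intersection adds the value 0 and
  replaces \<open>other\<close> by its \<open>bar\<close>, so that all earlier values acquire a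
  factor \<open>\<sigma>\<close> relative to the new label.\<close>

lemma run_build:
  assumes "run (build ls) [x, y] r' tr C"
  shows "\<exists>z w. r' = [z, w] \<and> joins (connect Vert ls) x y z w \<and>
    tr = zip (map snd ls) (map (\<lambda>e. e * B x (other (connect Vert ls) y z)) (weights \<sigma> Vert ls)) \<and>
    C \<subseteq> labs [x, other (connect Vert ls) y z]"
  using assms
proof (induction ls arbitrary: x y r' tr C rule: rev_induct)
  case Nil
  then show ?case by (auto simp: run_Nil)
next
  case (snoc l ls)
  obtain b c where l: "l = (b, c)" by fastforce
  let ?s = "connect Vert ls"
  show ?case
  proof (cases b)
    case True
    have "run (twist True c (build ls)) [x, y] r' tr C" using snoc.prems l True by simp
    then obtain z w tr1 C1 where 1: "run (build ls) [x, y] [w, z] tr1 C1" "r' = [z, w]"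
      "tr = tr1 @ [(c, B w z)]" "C = C1 \<union> labs [z, w]"
      unfolding run_twist_bottom[OF tangle_build] by blast
    have ih: "joins ?s x y w z"
      "tr1 = zip (map snd ls) (map (\<lambda>e. e * B x (other ?s y w)) (weights \<sigma> Vert ls))"
      "C1 \<subseteq> labs [x, other ?s y w]"
      using snoc.IH[OF 1(1)] by auto
    show ?thesis
      using 1 ih l True
      by (cases ?s) (auto simp: weights_snoc B_bar B_bar_right zip_append B_sym[of y x] mult_ac square_cancel comp_def)
  next
    case False
    have "run (twist False c (build ls)) [x, y] r' tr C" using snoc.prems l False by simp
    then obtain z w tr1 C1 where 1: "run (build ls) [x, bar w] [z, bar y] tr1 C1" "r' = [z, w]"
      "tr = tr1 @ [(c, B w y)]" "C = C1 \<union> labs [x, y, z, w]"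
      unfolding run_twist_right[OF tangle_build] by blast
    have ih: "joins ?s x (bar w) z (bar y)"
      "tr1 = zip (map snd ls) (map (\<lambda>e. e * B x (other ?s (bar w) z)) (weights \<sigma> Vert ls))"
      "C1 \<subseteq> labs [x, other ?s (bar w) z]"
      using snoc.IH[OF 1(1)] by auto
    show ?thesis
    proof (cases ?s)
      case Vert
      then have "z = x" "w = y" using ih(1) by (metis joins.simps(1) bar_bar)+
      then show ?thesis
        using 1(2-4) ih(2,3) l False Vert
        by (simp add: weights_snoc B_bar B_bar_right zip_append mult_ac comp_def; blast)
    next
      case Cro
      then have "z = bar w" "y = bar x" using ih(1) by (metis joins.simps(2) bar_bar)+
      then show ?thesis
        using 1(2-4) ih(2,3) l False Cro
        by (simp add: weights_snoc B_bar B_bar_right zip_append mult_ac comp_def square_cancel B_sym[of w x]; blast)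
    next
      case Hor
      then have "w = x" "z = y" using ih(1) by (metis joins.simps(3) bar_bar)+
      then show ?thesis
        using 1(2-4) ih(2,3) l False Hor
        by (simp add: weights_snoc B_bar B_bar_right zip_append mult_ac comp_def; blast)
    qed
  qed
qed

lemma run_buildD:
  assumes "run (build ls) [x, y] [z, w] tr C"
  shows "joins (connect Vert ls) x y z w"
    and "tr = zip (map snd ls) (map (\<lambda>e. e * B x (other (connect Vert ls) y z)) (weights \<sigma> Vert ls))"
    and "C \<subseteq> labs [x, other (connect Vert ls) y z]"
  using run_build[OF assms] by auto

text \<open>End labels can be prescribed freely subject to \<open>joins\<close>. This supplies
  orientations of the closure, and colourings that tell the two strands apart.\<close>

lemma run_build_exists:
  "joins (connect Vert ls) x y z w \<Longrightarrow> \<exists>tr C. run (build ls) [x, y] [z, w] tr C"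
proof (induction ls arbitrary: x y z w rule: rev_induct)
  case Nil
  then show ?case by (auto simp: run_Nil)
next
  case (snoc l ls)
  obtain b c where l: "l = (b, c)" by fastforce
  show ?case
  proof (cases b)
    case True
    have "joins (connect Vert ls) x y w z"
      using snoc.prems l True by (cases "connect Vert ls") auto
    from snoc.IH[OF this] obtain tr1 C1 where "run (build ls) [x, y] [w, z] tr1 C1" by blast
    then have "run (twist True c (build ls)) [x, y] [z, w] (tr1 @ [(c, B w z)]) (C1 \<union> labs [z, w])"
      unfolding run_twist_bottom[OF tangle_build] by blast
    then show ?thesis using l True by auto
  next
    case False
    have "joins (connect Vert ls) x (bar w) z (bar y)"
      using snoc.prems l False by (cases "connect Vert ls") auto
    from snoc.IH[OF this] obtain tr1 C1 where "run (build ls) [x, bar w] [z, bar y] tr1 C1" by blast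
    then have "run (twist False c (build ls)) [x, y] [z, w] (tr1 @ [(c, B w y)]) (C1 \<union> labs [x, y, z, w])"
      unfolding run_twist_right[OF tangle_build] by blast
    then show ?thesis using l False by auto
  qed
qed

end

section \<open>Components as labels\<close>

definition neq_indicator :: "'l \<Rightarrow> 'l \<Rightarrow> int" where
  "neq_indicator x y = (if x = y then 0 else 1)"

interpretation cl: labelling id neq_indicator 1
  by standard (auto simp: neq_indicator_def)

lemma adjacent_Cons:
  "adjacent w x y \<Longrightarrow> adjacent (t # w) (Suc (fst x), snd x) (Suc (fst y), snd y)"
proof (induction rule: adjacent.induct)
  case (left h p)
  then show ?case using adjacent.left[of "Suc h" "t # w" p] by simp
next
  case (right h p)
  then show ?case using adjacent.right[of "Suc h" "t # w" p] by (simp del: add_Suc_right)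
next
  case (cap h i)
  then show ?case using adjacent.cap[of "Suc h" "t # w" i] by simp
next
  case (cup h i)
  then show ?case using adjacent.cup[of "Suc h" "t # w" i] by simp
next
  case (cross_down h i x)
  then show ?case using adjacent.cross_down[of "Suc h" "t # w" i x] by simp
next
  case (cross_up h i x)
  then show ?case using adjacent.cross_up[of "Suc h" "t # w" i x] by simp
qed

section \<open>Passage between components and labellings\<close>

definition constant_along :: "'x step list \<Rightarrow> (nat \<times> nat \<Rightarrow> 'l) \<Rightarrow> bool" where
  "constant_along w f \<longleftrightarrow> (\<forall>x y. adjacent w x y \<longrightarrow> f x = f y)"

lemma constant_along_same_component:
  assumes "constant_along w f" "same_component w x y"
  shows "f x = f y"
  using assms(2) unfolding same_component_def
proof (induction rule: equivclp_induct)
  case (step y z)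
  then show ?case using assms(1) unfolding constant_along_def by metis
qed simp

lemma constant_along_class: "constant_along w (\<lambda>x. {y. same_component w x y})"
proof -
  have "{y. same_component w a y} = {y. same_component w b y}" if "adjacent w a b" for a b
  proof -
    have "same_component w a b" "same_component w b a"
      unfolding same_component_def using that by (auto intro: equivclp_sym)
    then show ?thesis unfolding same_component_def by (blast intro: equivclp_trans)
  qed
  then show ?thesis unfolding constant_along_def by blast
qed

lemma class_eq_iff:
  "{z. same_component w x z} = {z. same_component w y z} \<longleftrightarrow> same_component w x y"
  unfolding same_component_def by (blast intro: equivclp_trans equivclp_sym equivclp_refl)

lemma card_less_Suc_split:
  "card {h. h < Suc n \<and> P h} = (if P 0 then 1 else 0) + card {h. h < n \<and> P (Suc h)}"
proof -
  have "{h. h < Suc n \<and> P h} = (if P 0 then {0} else {}) \<union> Suc ` {h. h < n \<and> P (Suc h)}"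
    by (auto simp: image_iff less_Suc_eq_0_disj)
  then show ?thesis by (auto simp: card_image card_insert_if)
qed

definition row :: "(nat \<times> nat \<Rightarrow> 'l) \<Rightarrow> nat \<Rightarrow> nat \<Rightarrow> 'l list" where
  "row f h n = map (\<lambda>p. f (h, p)) [0..<n]"

lemma length_row [simp]: "length (row f h n) = n"
  by (simp add: row_def)

lemma nth_row [simp]: "p < n \<Longrightarrow> row f h n ! p = f (h, p)"
  by (simp add: row_def)

definition crossings_with :: "'x step list \<Rightarrow> (nat \<times> nat \<Rightarrow> nat \<times> nat \<Rightarrow> bool) \<Rightarrow> nat set" where
  "crossings_with w P = {h. h < length w \<and> (\<exists>i x. w ! h = Cross i x \<and> P (h, i) (h, Suc i))}"

lemma lstep_constant_along:
  assumes "constant_along (t # w) f" "pos t + ins t \<le> n"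
  shows "\<exists>tr. cl.lstep t (row f 0 n) (row f (Suc 0) (n - ins t + outs t)) tr \<and>
    length (filter (\<lambda>(x, v). v = 0) tr) = (if \<exists>i x. t = Cross i x \<and> f (0, i) = f (0, Suc i) then 1 else 0)"
proof -
  have adj: "f x = f y" if "adjacent (t # w) x y" for x y
    using that assms(1) unfolding constant_along_def by blast
  let ?r' = "row f (Suc 0) (n - ins t + outs t)"
  have left: "f (0, p) = f (Suc 0, p)" if "p < pos t" for p
    using adj[OF adjacent.left[of 0 "t # w" p]] that by simp
  have right: "f (0, p) = f (Suc 0, p - ins t + outs t)" if "pos t + ins t \<le> p" for p
    using adj[OF adjacent.right[of 0 "t # w" p]] that by simp
  have mid: "take (ins t) (drop (pos t) (row f 0 n)) = map (\<lambda>k. f (0, pos t + k)) [0..<ins t]"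
    using assms(2) by (intro nth_equalityI) auto
  have r': "?r' = take (pos t) (row f 0 n) @ map (\<lambda>k. f (Suc 0, pos t + k)) [0..<outs t] @
    drop (pos t + ins t) (row f 0 n)"
  proof (rule nth_equalityI)
    show "length ?r' = length (take (pos t) (row f 0 n) @ map (\<lambda>k. f (Suc 0, pos t + k)) [0..<outs t] @
      drop (pos t + ins t) (row f 0 n))"
      using assms(2) by simp
  next
    fix p assume p: "p < length ?r'"
    consider "p < pos t" | "pos t \<le> p" "p < pos t + outs t" | "pos t + outs t \<le> p" by linarith
    then show "?r' ! p = (take (pos t) (row f 0 n) @ map (\<lambda>k. f (Suc 0, pos t + k)) [0..<outs t] @
      drop (pos t + ins t) (row f 0 n)) ! p"
    proof cases
      case 1
      then show ?thesis using p assms(2) left[of p] by (simp add: nth_append)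
    next
      case 2
      then have "p - pos t < outs t" by linarith
      then show ?thesis using 2 p assms(2) by (simp add: nth_append)
    next
      case 3
      then have "\<not> p - pos t < outs t" by linarith
      then show ?thesis using 3 p assms(2) right[of "p - outs t + ins t"]
        by (simp add: nth_append add.commute)
    qed
  qed
  have "\<exists>tr. cl.piece t (map (\<lambda>k. f (0, pos t + k)) [0..<ins t]) (map (\<lambda>k. f (Suc 0, pos t + k)) [0..<outs t]) tr \<and>
    length (filter (\<lambda>(x, v). v = 0) tr) = (if \<exists>i x. t = Cross i x \<and> f (0, i) = f (0, Suc i) then 1 else 0)"
  proof (cases t)
    case (Cap i)
    then have "f (Suc 0, Suc i) = f (Suc 0, i)"
      using adj[OF adjacent.cap[of 0 "t # w" i]] by simp
    then show ?thesis using Cap cl.piece.cap[of i "f (Suc 0, i)"]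
      by (intro exI[of _ "[]"]) (simp add: upt_rec)
  next
    case (Cup i)
    then have "f (0, Suc i) = f (0, i)"
      using adj[OF adjacent.cup[of 0 "t # w" i]] by simp
    then show ?thesis using Cup cl.piece.cup[of i "f (0, i)"]
      by (intro exI[of _ "[]"]) (simp add: upt_rec)
  next
    case (Cross i c)
    then have "f (Suc 0, Suc i) = f (0, i)" "f (Suc 0, i) = f (0, Suc i)"
      using adj[OF adjacent.cross_down[of 0 "t # w" i c]] adj[OF adjacent.cross_up[of 0 "t # w" i c]]
      by simp_all
    then show ?thesis using Cross cl.piece.cross[of i c "f (0, i)" "f (0, Suc i)"]
      by (intro exI[of _ "[(c, neq_indicator (f (0, i)) (f (0, Suc i)))]"])
         (simp add: upt_rec neq_indicator_def)
  qed
  then show ?thesis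
    unfolding cl.lstep_iff mid using assms(2) r' by auto
qed

lemma row_Suc: "row (\<lambda>(h, p). f (Suc h, p)) h n = row f (Suc h) n"
  by (simp add: row_def)

text \<open>This turns components, which are classes of a relation on nodes, into labellings, which
  can be followed step by step. The value 0 in the trace marks a crossing where the two labels
  agree.\<close>

lemma run_constant_along:
  assumes "constant_along w f" "tangle n w m"
  shows "\<exists>tr C. cl.run w (row f 0 n) (row f (length w) m) tr C \<and> f ` nodes n w \<subseteq> C \<and>
    length (filter (\<lambda>(x, v). v = 0) tr) = card (crossings_with w (\<lambda>a b. f a = f b))"
  using assms
proof (induction w arbitrary: f n)
  case Nil
  have "f ` nodes n [] \<subseteq> cl.labs (row f 0 n)"
    by (auto simp: nodes_def cl.labs_def row_def)
  moreover have "cl.run [] (row f 0 n) (row f (length []) m) [] (cl.labs (row f 0 n))"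
    using cl.run.Nil[of "row f 0 n"] Nil.prems(2) by simp
  moreover have "length (filter (\<lambda>(x, v). v = 0) []) = card (crossings_with [] (\<lambda>a b. f a = f b))"
    by (simp add: crossings_with_def)
  ultimately show ?case by blast
next
  case (Cons t w)
  let ?g = "\<lambda>(h, p). f (Suc h, p)" and ?n = "n - ins t + outs t"
  have g: "constant_along w ?g"
    using Cons.prems(1) adjacent_Cons[of w _ _ t] unfolding constant_along_def by fastforce
  have t: "pos t + ins t \<le> n" "tangle ?n w m" using Cons.prems(2) by auto
  obtain tr C where ih: "cl.run w (row ?g 0 ?n) (row ?g (length w) m) tr C" "?g ` nodes ?n w \<subseteq> C"
    "length (filter (\<lambda>(x, v). v = 0) tr) = card (crossings_with w (\<lambda>a b. ?g a = ?g b))"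
    using Cons.IH[OF g t(2)] by blast
  obtain tr1 where st: "cl.lstep t (row f 0 n) (row f (Suc 0) ?n) tr1"
    "length (filter (\<lambda>(x, v). v = 0) tr1) = (if \<exists>i x. t = Cross i x \<and> f (0, i) = f (0, Suc i) then 1 else 0)"
    using lstep_constant_along[OF Cons.prems(1) t(1)] by blast
  have "cl.run (t # w) (row f 0 n) (row f (length (t # w)) m) (tr1 @ tr) (cl.labs (row f 0 n) \<union> C)"
    using cl.run.Cons[OF st(1)] ih(1) by (simp add: row_Suc)
  moreover have "f ` nodes n (t # w) \<subseteq> cl.labs (row f 0 n) \<union> C"
  proof
    fix y assume "y \<in> f ` nodes n (t # w)"
    then obtain h p where y: "y = f (h, p)" "h \<le> Suc (length w)" "p < width n (take h (t # w))"
      by (auto simp: nodes_def)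
    show "y \<in> cl.labs (row f 0 n) \<union> C"
    proof (cases h)
      case 0
      then show ?thesis using y by (auto simp: cl.labs_def row_def)
    next
      case (Suc k)
      then have "(k, p) \<in> nodes ?n w" using y by (simp add: nodes_def)
      then have "?g (k, p) \<in> C" using ih(2) by blast
      then show ?thesis using y Suc by simp
    qed
  qed
  moreover have "length (filter (\<lambda>(x, v). v = 0) (tr1 @ tr)) = card (crossings_with (t # w) (\<lambda>a b. f a = f b))"
    unfolding crossings_with_def using st(2) ih(3)
    by (simp add: card_less_Suc_split crossings_with_def)
  ultimately show ?case by blast
qed

lemma constant_along_of_run:
  assumes "cl.run w r r' tr C"
  shows "\<exists>f. constant_along w f \<and> (\<forall>p<length r. f (0, p) = r ! p) \<and> (\<forall>p<length r'. f (length w, p) = r' ! p)"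
proof -
  \<comment> \<open>\<open>adjacent\<close> also links positions beyond the width of a row, so all
    of these receive one common default label.\<close>
  define pad where "pad r p = (if p < length r then r ! p else undefined)" for r :: "'a list" and p
  have "\<exists>f. constant_along w f \<and> (\<forall>p. f (0, p) = pad r p) \<and> (\<forall>p. f (length w, p) = pad r' p)"
    using assms
  proof (induction rule: cl.run.induct)
    case (Nil r)
    show ?case by (intro exI[of _ "\<lambda>(h, p). pad r p"]) (auto simp: constant_along_def elim!: adjacent.cases)
  next
    case (Cons t r r' tr w r'' tr' C)
    then obtain f where f: "constant_along w f" "\<forall>p. f (0, p) = pad r' p" "\<forall>p. f (length w, p) = pad r'' p"
      by blast
    obtain a b p p' where ab: "r = a @ p @ b" "r' = a @ p' @ b" "length a = pos t" "cl.piece t p p' tr"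
      using Cons.hyps(1) unfolding cl.lstep_def by blast
    note len = cl.piece_lengths[OF ab(4)]
    let ?g = "\<lambda>(h, q). if h = 0 then pad r q else f (h - 1, q)"
    have left0: "pad r q = pad r' q" if "q < pos t" for q
      using that ab by (simp add: pad_def nth_append)
    have right0: "pad r q = pad r' (q - ins t + outs t)" if "pos t + ins t \<le> q" for q
      using that ab len by (auto simp: pad_def nth_append add.commute)
    have tail: "f (k, q) = f (k', q')" if "adjacent w (k, q) (k', q')" for k q k' q'
      using that f(1) unfolding constant_along_def by blast
    have "?g x = ?g y" if "adjacent (t # w) x y" for x y
      using that
    proof cases
      case (left h q)
      show ?thesis
      proof (cases h)
        case 0
        then show ?thesis using left left0[of q] f(2) by simp
      next
        case (Suc k)
        then show ?thesis using left tail[OF adjacent.left[of k w q]] by simp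
      qed
    next
      case (right h q)
      show ?thesis
      proof (cases h)
        case 0
        then show ?thesis using right right0[of q] f(2) by simp
      next
        case (Suc k)
        then show ?thesis using right tail[OF adjacent.right[of k w q]] by simp
      qed
    next
      case (cap h i)
      show ?thesis
      proof (cases h)
        case 0
        with cap ab(4) obtain x' where p: "p = []" "p' = [x', x']" by (auto simp: cl.piece_simps)
        show ?thesis using 0 cap f(2) ab(2,3) by (simp add: p pad_def nth_append)
      next
        case (Suc k)
        then show ?thesis using cap tail[OF adjacent.cap[of k w i]] by simp
      qed
    next
      case (cup h i)
      show ?thesis
      proof (cases h)
        case 0
        with cup ab(4) obtain x' where p: "p = [x', x']" by (auto simp: cl.piece_simps)
        show ?thesis using 0 cup ab(1,3) by (simp add: p pad_def nth_append)
      next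
        case (Suc k)
        then show ?thesis using cup tail[OF adjacent.cup[of k w i]] by simp
      qed
    next
      case (cross_down h i c)
      show ?thesis
      proof (cases h)
        case 0
        with cross_down ab(4) obtain x' y' where p: "p = [x', y']" "p' = [y', x']"
          by (auto simp: cl.piece_simps)
        show ?thesis using 0 cross_down ab(1-3) f(2) by (simp add: p pad_def nth_append)
      next
        case (Suc k)
        then show ?thesis using cross_down tail[OF adjacent.cross_down[of k w i c]] by simp
      qed
    next
      case (cross_up h i c)
      show ?thesis
      proof (cases h)
        case 0
        with cross_up ab(4) obtain x' y' where p: "p = [x', y']" "p' = [y', x']"
          by (auto simp: cl.piece_simps)
        show ?thesis using 0 cross_up ab(1-3) f(2) by (simp add: p pad_def nth_append)
      next
        case (Suc k)
        then show ?thesis using cross_up tail[OF adjacent.cross_up[of k w i c]] by simp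
      qed
    qed
    then have "constant_along (t # w) ?g" by (simp add: constant_along_def)
    then show ?case using f(3) by (intro exI[of _ ?g]) simp
  qed
  then show ?thesis unfolding pad_def by metis
qed

text \<open>Used as the finest labelling: the label of a node is its own class.\<close>

definition component_of :: "'x step list \<Rightarrow> nat \<times> nat \<Rightarrow> (nat \<times> nat) set" where
  "component_of w x = {y. same_component w x y}"

lemma constant_along_component_of: "constant_along w (component_of w)"
  using constant_along_class unfolding component_of_def .

lemma component_of_eq_iff: "component_of w x = component_of w y \<longleftrightarrow> same_component w x y"
  unfolding component_of_def by (rule class_eq_iff)

lemma self_intersections_eq:
  "self_intersections w = crossings_with w (\<lambda>a b. component_of w a = component_of w b)"
  unfolding self_intersections_def crossings_with_def component_of_eq_iff ..

lemma row_0: "row f h 0 = []"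
  by (simp add: row_def)

lemma row_2: "row f h 2 = [f (h, 0), f (h, Suc 0)]"
  by (simp add: row_def upt_rec numeral_2_eq_2)

section \<open>Counting self-intersections\<close>

lemma zeros_weights:
  "length (filter (\<lambda>(x, v). v = 0) (zip (map snd ls) (map (\<lambda>e. e * 1) (weights 1 s ls)))) = length (selfs s ls)"
  by (induction s ls rule: selfs.induct) auto

lemma mutuals_if_nonzero_weight:
  "(x, v) \<in> set (zip (map snd ls) (map (\<lambda>e. e * k) (weights \<sigma> s ls))) \<Longrightarrow> v \<noteq> 0 \<Longrightarrow> mutuals s ls \<noteq> []"
  by (induction s ls rule: mutuals.induct) auto

text \<open>If the two strands belonged to one component, every labelling would give them the same
  label; but some Boolean labelling is True on one strand and False on the other.\<close>

lemma endpoints_distinct: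
  assumes "constant_along (build ls) f" "\<And>x y. f x = f y \<longleftrightarrow> same_component (build ls) x y"
    and "cl.run (build ls) (row f 0 2) (row f (length (build ls)) 2) tr C"
  shows "f (0, 0) \<noteq> cl.other (connect Vert ls) (f (0, Suc 0)) (f (length (build ls), 0))"
proof
  let ?s = "connect Vert ls" and ?m = "length (build ls)"
  assume eq: "f (0, 0) = cl.other ?s (f (0, Suc 0)) (f (?m, 0))"
  \<comment> \<open>The node from which \<open>other\<close> takes its label.\<close>
  define v where "v = (if ?s = Hor then (?m, 0) else (0 :: nat, Suc 0))"
  have "f (0, 0) = f v" using eq by (cases ?s) (auto simp: v_def)
  then have same: "same_component (build ls) (0, 0) v" using assms(2) by blast
  \<comment> \<open>The three Booleans say whether NE, SW and SE, respectively, lie on the strand of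
    NW.\<close>
  obtain y z w where yzw: "cl.joins ?s True y z w" "cl.other ?s y z = False"
    by (rule that[of "?s = Hor" "?s = Vert" "?s = Cro"]) (cases ?s; simp)+
  from cl.run_build_exists[OF yzw(1)] obtain tr' C' where "cl.run (build ls) [True, y] [z, w] tr' C'"
    by blast
  from constant_along_of_run[OF this] obtain g where g: "constant_along (build ls) g"
    "\<forall>p<length [True, y]. g (0, p) = [True, y] ! p" "\<forall>p<length [z, w]. g (?m, p) = [z, w] ! p"
    by blast
  have "g (0, 0)" "g (0, Suc 0) = y" "g (?m, 0) = z" using g(2,3) by auto
  moreover have "g (0, 0) = g v" by (rule constant_along_same_component[OF g(1) same])
  ultimately show False using yzw by (cases ?s) (auto simp: v_def)
qed

text \<open>The two strands have different labels, so the common factor in the trace is 1 and the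
  trace values are exactly the weights.\<close>

lemma run_components:
  obtains tr C where "cl.run (build ls) (row (component_of (build ls)) 0 2)
      (row (component_of (build ls)) (length (build ls)) 2) tr C"
    "tr = zip (map snd ls) (map (\<lambda>e. e * 1) (weights 1 Vert ls))"
    "length (filter (\<lambda>(x, v). v = 0) tr) = card (self_intersections (build ls))"
proof -
  let ?T = "build ls" and ?f = "component_of (build ls)"
  obtain tr C where run: "cl.run ?T (row ?f 0 2) (row ?f (length ?T) 2) tr C"
    "length (filter (\<lambda>(x, v). v = 0) tr) = card (self_intersections ?T)"
    using run_constant_along[OF constant_along_component_of tangle_build] unfolding self_intersections_eq
    by blast
  have "tr = zip (map snd ls) (map (\<lambda>e. e * neq_indicator (?f (0, 0))
      (cl.other (connect Vert ls) (?f (0, Suc 0)) (?f (length ?T, 0)))) (weights 1 Vert ls))"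
    by (rule cl.run_buildD(2)[OF run(1)[unfolded row_2]])
  moreover have "neq_indicator (?f (0, 0))
      (cl.other (connect Vert ls) (?f (0, Suc 0)) (?f (length ?T, 0))) = 1"
    using endpoints_distinct[OF constant_along_component_of component_of_eq_iff run(1)]
    by (simp add: neq_indicator_def)
  ultimately show thesis using that run by simp
qed

lemma card_self_intersections: "card (self_intersections (build ls)) = length (selfs Vert ls)"
proof -
  obtain tr C where "tr = zip (map snd ls) (map (\<lambda>e. e * 1) (weights 1 Vert ls))"
    "length (filter (\<lambda>(x, v). v = 0) tr) = card (self_intersections (build ls))"
    by (rule run_components)
  then show ?thesis using zeros_weights[of ls Vert] by simp
qed

lemma length_run_trace: "cl.run w r r' tr C \<Longrightarrow> length tr = card {h. h < length w \<and> (\<exists>i x. w ! h = Cross i x)}"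
proof (induction rule: cl.run.induct)
  case (Cons t r r' tr w r'' tr' C)
  then have "length tr = (if \<exists>i x. t = Cross i x then 1 else 0)"
    unfolding cl.lstep_def by (cases t) (auto simp: cl.piece_simps)
  then show ?case using Cons.IH by (simp add: card_less_Suc_split)
qed simp

text \<open>The trace gives the number of self-intersections but not their places in the word. So it
  is compared with the number of all crossings: if the two agree, every crossing is a
  self-intersection.\<close>

lemma mutuals_nonempty:
  assumes "non_self_intersections (build ls) \<noteq> {}"
  shows "mutuals Vert ls \<noteq> []"
proof
  assume *: "mutuals Vert ls = []"
  let ?T = "build ls"
  let ?K = "{h. h < length ?T \<and> (\<exists>i x. ?T ! h = Cross i x)}"
  obtain tr C where tr: "cl.run ?T (row (component_of ?T) 0 2) (row (component_of ?T) (length ?T) 2) tr C"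
    "tr = zip (map snd ls) (map (\<lambda>e. e * 1) (weights 1 Vert ls))"
    "length (filter (\<lambda>(x, v). v = 0) tr) = card (self_intersections ?T)"
    by (rule run_components)
  have "\<forall>p\<in>set tr. (case p of (x, v) \<Rightarrow> v = 0)"
  proof
    fix p assume "p \<in> set tr"
    then have "(fst p, snd p) \<in> set tr" by simp
    from mutuals_if_nonzero_weight[OF this[unfolded tr(2)]] * have "snd p = 0" by blast
    then show "case p of (x, v) \<Rightarrow> v = 0" by (simp add: case_prod_beta)
  qed
  then have "filter (\<lambda>(x, v). v = 0) tr = tr" by (simp only: filter_id_conv)
  then have "card (self_intersections ?T) = card ?K"
    using tr(3) length_run_trace[OF tr(1)] by (simp only:)
  moreover have "self_intersections ?T \<subseteq> ?K" unfolding self_intersections_def by blast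
  moreover have "finite ?K" by simp
  ultimately have eq: "self_intersections ?T = ?K" by (intro card_subset_eq)
  obtain h where h: "h \<in> non_self_intersections ?T" using assms by blast
  then have "h \<in> ?K" unfolding non_self_intersections_def by blast
  then have "h \<in> self_intersections ?T" unfolding eq .
  with h show False unfolding self_intersections_def non_self_intersections_def by clarsimp
qed

section \<open>Labellings of the closures and the number of components\<close>

fun closing :: "closure_kind \<Rightarrow> connection" where
  "closing Numerator = Hor"
| "closing Denominator = Vert"

context labelling
begin

text \<open>The closing arcs relate the four end labels exactly as a tangle of type
  \<open>closing k\<close> would, and up to \<open>bar\<close> they carry no further labels.\<close>

lemma run_closure:
  assumes "tangle 2 T 2"
  shows "run (tangle_closure k T) [] [] tr C \<longleftrightarrow>
    (\<exists>x y z w. run T [x, y] [z, w] tr C \<and> joins (closing k) x y z w)"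
proof (cases k)
  case Numerator
  show ?thesis
  proof
    assume "run (tangle_closure k T) [] [] tr C"
    then have "run (Cap 0 # T @ [Cup 0]) [] [] tr C" using Numerator by simp
    then obtain x C0 where C0: "run (T @ [Cup 0]) [x, bar x] [] tr C0" "C = C0"
      unfolding run_Cons lstep_local by auto
    from C0(1) obtain r1 tr1 tr2 C1 C2 where
      1: "run T [x, bar x] r1 tr1 C1" "run [Cup 0] r1 [] tr2 C2" "tr = tr1 @ tr2" "C0 = C1 \<union> C2"
      by (rule run_appendE)
    have "length r1 = 2" using run_tangle[OF 1(1)] assms tangle_unique[of 2 T "length r1" 2]
      by (simp add: numeral_2_eq_2)
    then obtain z w where r1: "r1 = [z, w]" by (rule length_2E)
    from 1(2) have 2: "w = bar z" "tr2 = []" "C2 = labs [z, w]"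
      unfolding r1 by (auto simp: run_simps)
    have "C = C1" using 1(4) C0(2) 2(3) run_labs[OF 1(1)] r1 by blast
    then show "\<exists>x y z w. run T [x, y] [z, w] tr C \<and> joins (closing k) x y z w"
      using 1(1,3) 2 r1 Numerator by auto
  next
    assume "\<exists>x y z w. run T [x, y] [z, w] tr C \<and> joins (closing k) x y z w"
    then obtain x z where 1: "run T [x, bar x] [z, bar z] tr C" using Numerator by auto
    have "run [Cup 0] [z, bar z] [] [] (labs [z, bar z])" by (simp add: run_simps)
    from run_append[OF 1 this] have 2: "run (T @ [Cup 0]) [x, bar x] [] tr C"
      using run_labs[OF 1] by (simp add: insert_absorb)
    have "lstep (Cap 0) [] [x, bar x] []" unfolding lstep_local by blast
    from run.Cons[OF this 2] show "run (tangle_closure k T) [] [] tr C" using Numerator by simp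
  qed
next
  case Denominator
  let ?T = "map (shift_step 1) T"
  show ?thesis
  proof
    assume "run (tangle_closure k T) [] [] tr C"
    then have "run (Cap 0 # Cap 2 # ?T @ [Cup 2, Cup 0]) [] [] tr C" using Denominator by simp
    then obtain a b C0 where C0: "run (?T @ [Cup 2, Cup 0]) [a, bar a, b, bar b] [] tr C0"
        "C = labs [a, bar a] \<union> C0"
      by (auto simp: run_Cons lstep_local)
    from C0(1) obtain r1 tr1 tr2 C1 C2 where
      1: "run ?T [a, bar a, b, bar b] r1 tr1 C1" "run [Cup 2, Cup 0] r1 [] tr2 C2"
      "tr = tr1 @ tr2" "C0 = C1 \<union> C2"
      by (rule run_appendE)
    have 2: "run (map (shift_step (length [a])) T) ([a] @ [bar a, b] @ [bar b]) r1 tr1 C1"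
      using 1(1) by simp
    obtain r0 C3 where 3: "r1 = [a] @ r0 @ [bar b]" "run T [bar a, b] r0 tr1 C3"
      "C1 = labs [a] \<union> labs [bar b] \<union> C3"
    proof (rule run_frameE[OF 2])
      show "tangle (length [bar a, b]) T 2" using assms by (simp add: numeral_2_eq_2)
    qed
    have "length r0 = 2" using run_tangle[OF 3(2)] assms tangle_unique[of 2 T "length r0" 2]
      by (simp add: numeral_2_eq_2)
    then obtain z w where r0: "r0 = [z, w]" by (rule length_2E)
    have "bar b = bar w" using 1(2) unfolding 3(1) r0 by (auto simp: run_simps)
    then have "w = b" by (metis bar_bar)
    with 1(2) have "z = bar a" and 4: "tr2 = []" "C2 = labs [a, z, w, bar b] \<union> labs [a, z]"
      unfolding 3(1) r0 by (auto simp: run_simps)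
    note zw = \<open>z = bar a\<close> \<open>w = b\<close>
    have "labs [bar a, b] \<subseteq> C3" using run_labs[OF 3(2)] by blast
    then have "labs [a, bar a] \<subseteq> C3" "labs [a] \<subseteq> C3" "labs [bar b] \<subseteq> C3"
      "labs [a, z, w, bar b] \<subseteq> C3" "labs [a, z] \<subseteq> C3"
      unfolding zw by simp_all
    then have "C = C3"
      unfolding C0(2) 1(4) 3(3) 4(2) by blast
    then show "\<exists>x y z w. run T [x, y] [z, w] tr C \<and> joins (closing k) x y z w"
      using 3(2) 1(3) 4(1) r0 zw Denominator by auto
  next
    assume "\<exists>x y z w. run T [x, y] [z, w] tr C \<and> joins (closing k) x y z w"
    then obtain x y where 1: "run T [x, y] [x, y] tr C" using Denominator by auto
    have C: "labs [x, y] \<subseteq> C" using run_labs[OF 1] by blast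
    have "run ?T [bar x, x, y, bar y] [bar x, x, y, bar y] tr (labs [bar x] \<union> labs [bar y] \<union> C)"
      using run_frame[OF 1, of "[bar x]" "[bar y]"] by simp
    moreover have "run [Cup 2, Cup 0] [bar x, x, y, bar y] [] []
      (labs [bar x, x, y, bar y] \<union> labs [bar x, x])" by (auto simp: run_simps)
    ultimately have 2: "run (?T @ [Cup 2, Cup 0]) [bar x, x, y, bar y] [] (tr @ [])
      ((labs [bar x] \<union> labs [bar y] \<union> C) \<union> (labs [bar x, x, y, bar y] \<union> labs [bar x, x]))"
      by (rule run_append)
    have "lstep (Cap 0) [] [bar x, x] []" "lstep (Cap 2) [bar x, x] [bar x, x, y, bar y] []"
      unfolding lstep_local by auto
    from run.Cons[OF this(1) run.Cons[OF this(2) 2]] have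
      "run (tangle_closure k T) [] [] tr (labs [] \<union> (labs [bar x, x] \<union>
       ((labs [bar x] \<union> labs [bar y] \<union> C) \<union> (labs [bar x, x, y, bar y] \<union> labs [bar x, x]))))"
      using Denominator by simp
    moreover have "labs [] \<union> (labs [bar x, x] \<union>
       ((labs [bar x] \<union> labs [bar y] \<union> C) \<union> (labs [bar x, x, y, bar y] \<union> labs [bar x, x]))) = C"
    proof -
      have "labs [bar x] \<subseteq> C" "labs [bar y] \<subseteq> C" "labs [bar x, x] \<subseteq> C"
        "labs [bar x, x, y, bar y] \<subseteq> C" "labs [] \<subseteq> C"
        using C by simp_all
      then show ?thesis by blast
    qed
    ultimately show "run (tangle_closure k T) [] [] tr C" by (simp only:)
  qed
qed

end

text \<open>With \<open>bar = id\<close>, two different pairings of the four ends together connect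
  all of them, so only one label is left.\<close>

lemma other_eq_if_joins:
  assumes "cl.joins s x y z w" "cl.joins (closing k) x y z w" "s \<noteq> closing k"
  shows "cl.other s y z = x"
proof (cases s)
  case Vert
  then show ?thesis
    using assms by (metis cl.joins.simps(1,3) cl.other.simps(1) closing.elims id_apply)
next
  case Cro
  then show ?thesis
    using assms by (metis cl.joins.simps cl.other.simps(2) closing.elims id_apply)
next
  case Hor
  then show ?thesis
    using assms by (metis cl.joins.simps(1,3) cl.other.simps(3) closing.elims id_apply)
qed

lemma labs_twice: "cl.labs [x, x] = {x}"
  by (simp add: cl.labs_def)

lemma run_two_component_closure:
  assumes "cl.run (tangle_closure k (build ls)) [] [] tr C" "connect Vert ls \<noteq> closing k"
  obtains x where "C \<subseteq> {x}"
proof -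
  obtain x y z w where xyzw: "cl.run (build ls) [x, y] [z, w] tr C" "cl.joins (closing k) x y z w"
    using assms(1) unfolding cl.run_closure[OF tangle_build] by blast
  have "cl.other (connect Vert ls) y z = x"
    by (rule other_eq_if_joins[OF cl.run_buildD(1)[OF xyzw(1)] xyzw(2) assms(2)])
  with cl.run_buildD(3)[OF xyzw(1)] have "C \<subseteq> {x}" by (simp only: labs_twice)
  then show thesis by (rule that)
qed

lemma card_components_le_one:
  assumes "component_of w ` nodes n w \<subseteq> {x}"
  shows "card (components n w) \<le> 1"
proof -
  have "c = nodes n w \<inter> x" if c: "c \<in> components n w" for c
  proof -
    obtain v where v: "v \<in> nodes n w" "c = {y \<in> nodes n w. same_component w v y}"
      using c unfolding components_def by blast
    have x: "component_of w v = x"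
      by (rule singletonD[OF subsetD[OF assms imageI[OF v(1)]]])
    show ?thesis unfolding v(2) x[symmetric] component_of_def by blast
  qed
  then have "components n w \<subseteq> {nodes n w \<inter> x}" by blast
  from card_mono[OF _ this] show ?thesis by simp
qed

text \<open>For any other type the labelling by components would use a single label, so the closure
  would have at most one component.\<close>

lemma connect_eq_closing:
  assumes "two_component_link (tangle_closure k (build ls))"
  shows "connect Vert ls = closing k"
proof (rule ccontr)
  assume neq: "connect Vert ls \<noteq> closing k"
  define D where "D = tangle_closure k (build ls)"
  have D: "tangle 0 D 0" "card (components 0 D) = 2"
    using assms unfolding D_def two_component_link_def closed_def by blast+
  obtain tr C where
    run: "cl.run D [] [] tr C" "component_of D ` nodes 0 D \<subseteq> C"
    using run_constant_along[OF constant_along_component_of D(1)] unfolding row_0 by blast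
  obtain x where "C \<subseteq> {x}"
    by (rule run_two_component_closure[OF run(1)[unfolded D_def] neq])
  with run(2) have "component_of D ` nodes 0 D \<subseteq> {x}" by (rule subset_trans)
  from card_components_le_one[OF this] show False using D(2) by simp
qed

section \<open>Linked diagrams are not splittable\<close>

text \<open>In a label the first entry is a colour and the second a vertical direction, which is
  reversed at a maximum or minimum.\<close>

definition rev_dir :: "bool \<times> bool \<Rightarrow> bool \<times> bool" where
  "rev_dir = (\<lambda>(c, d). (c, \<not> d))"

text \<open>Multiplied by \<open>sgn_slope\<close> this is the usual sign of a crossing between the
  two colours, so \<open>total\<close> is twice the linking number of the two coloured
  sublinks.\<close>

definition meet_sign :: "bool \<times> bool \<Rightarrow> bool \<times> bool \<Rightarrow> int" where
  "meet_sign = (\<lambda>(c, d) (c', d'). if c = c' then 0 else if d = d' then 1 else -1)"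

lemma rev_dir_simp [simp]: "rev_dir (c, d) = (c, \<not> d)"
  by (simp add: rev_dir_def)

lemma fst_rev_dir [simp]: "fst (rev_dir l) = fst l"
  by (cases l) simp

lemma snd_rev_dir: "snd (rev_dir l) = (\<not> snd l)"
  by (cases l) simp

lemma meet_sign_simp [simp]:
  "meet_sign (c, d) (c', d') = (if c = c' then 0 else if d = d' then 1 else -1)"
  by (simp add: meet_sign_def)

interpretation lk: oriented_labelling rev_dir meet_sign
  by standard auto

lemma lk_lstep_recolour:
  assumes "lk.lstep t r r' tr"
  shows "\<exists>tr'. lk.lstep t (map (\<lambda>l. (c, snd l)) r) (map (\<lambda>l. (c, snd l)) r') tr' \<and> total tr' = 0"
proof -
  let ?f = "map (\<lambda>l. (c, snd l))"
  obtain a p p' b where *: "r = a @ p @ b" "r' = a @ p' @ b" "length a = pos t" "lk.piece t p p' tr"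
    using assms unfolding lk.lstep_def by blast
  have "\<exists>tr'. lk.piece t (?f p) (?f p') tr' \<and> total tr' = 0"
    using *(4)
  proof cases
    case (cap i x)
    then show ?thesis
      using lk.piece.cap[of i "(c, snd x)"] by (intro exI[of _ "[]"]) (simp add: snd_rev_dir)
  next
    case (cup i x)
    then show ?thesis
      using lk.piece.cup[of i "(c, snd x)"] by (intro exI[of _ "[]"]) (simp add: snd_rev_dir)
  next
    case (cross i k x y)
    then show ?thesis
      using lk.piece.cross[of i k "(c, snd x)" "(c, snd y)"]
      by (intro exI[of _ "[(k, 0)]"]) simp
  qed
  then obtain tr' where "lk.piece t (?f p) (?f p') tr'" "total tr' = 0" by blast
  moreover have "lk.lstep t (?f r) (?f r') tr'"
    unfolding *(1,2) map_append by (rule lk.lstepI) (use calculation(1) *(3) in simp_all)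
  ultimately show ?thesis by blast
qed

lemma lk_labs_recolour:
  "fst ` lk.labs (map (\<lambda>l. (c, snd l)) r) \<subseteq> {c}"
  "lk.labs (map (\<lambda>l. (c, snd l)) r) = {} \<longleftrightarrow> lk.labs r = {}"
  by (auto simp: lk.labs_def)

text \<open>Directions are kept, and crossings within one colour count 0. The last clause serves to
  show later that the colour really occurs.\<close>

lemma lk_run_recolour:
  "lk.run w r r' tr C \<Longrightarrow> \<exists>tr' C'. lk.run w (map (\<lambda>l. (c, snd l)) r) (map (\<lambda>l. (c, snd l)) r') tr' C' \<and>
    total tr' = 0 \<and> fst ` C' \<subseteq> {c} \<and> (C \<noteq> {} \<longrightarrow> C' \<noteq> {})"
proof (induction rule: lk.run.induct)
  case (Nil r)
  with lk.run.Nil[of "map (\<lambda>l. (c, snd l)) r"] lk_labs_recolour[of c r] show ?case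
    using total_simps(1) by blast
next
  case (Cons t r r' tr w r'' tr2 C)
  from Cons.IH obtain tr' C' where ih:
    "lk.run w (map (\<lambda>l. (c, snd l)) r') (map (\<lambda>l. (c, snd l)) r'') tr' C'" "total tr' = 0"
    "fst ` C' \<subseteq> {c}" "C \<noteq> {} \<longrightarrow> C' \<noteq> {}"
    by blast
  from lk_lstep_recolour[OF Cons.hyps(1), of c] obtain tr1 where t:
    "lk.lstep t (map (\<lambda>l. (c, snd l)) r) (map (\<lambda>l. (c, snd l)) r') tr1" "total tr1 = 0"
    by blast
  let ?C = "lk.labs (map (\<lambda>l. (c, snd l)) r) \<union> C'"
  have "fst ` ?C \<subseteq> {c}" "lk.labs r \<union> C \<noteq> {} \<longrightarrow> ?C \<noteq> {}"
    using ih(3,4) lk_labs_recolour[of c r] unfolding image_Un by simp_all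
  moreover have "total (tr1 @ tr') = 0" using ih(2) t(2) by simp
  ultimately show ?case using lk.run.Cons[OF t(1) ih(1)] by blast
qed

lemma closed_nonempty_Cap:
  assumes "closed w" "w \<noteq> []"
  obtains w' where "w = Cap 0 # w'"
  using assms unfolding closed_def by (cases w; cases "hd w") auto

lemma lk_run_closed_nonempty:
  assumes "lk.run w [] [] tr C" "w \<noteq> []"
  shows "C \<noteq> {}"
proof -
  have "closed w" using lk.run_tangle[OF assms(1)] by (simp add: closed_def)
  then obtain w' where w: "w = Cap 0 # w'" using assms(2) by (rule closed_nonempty_Cap)
  obtain r tr' tr'' C' where "lk.lstep (Cap 0 :: 'a step) [] r tr'" "lk.run w' r [] tr'' C'" "C = C'"
    using assms(1) unfolding w lk.run_Cons by auto
  then show ?thesis using lk.run_labs[of w' r "[]" tr'' C'] by (auto simp: lk.lstep_local)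
qed

text \<open>Separated parts can be coloured independently, each keeping the orientation it already has.\<close>

lemma lk_run_separated:
  assumes "separated_by_circle D" "lk.run D [] [] tr C"
  shows "\<exists>tr' C'. lk.run D [] [] tr' C' \<and> total tr' = 0 \<and> fst ` C' = UNIV"
proof -
  obtain A L B k where D: "D = A @ map (shift_step k) L @ B" "closed L" "L \<noteq> []" "A @ B \<noteq> []"
    using assms(1) unfolding separated_by_circle_def by blast
  obtain r tr1 tr4 C1 C4 where
    r1: "lk.run A [] r tr1 C1" "lk.run (map (shift_step k) L @ B) r [] tr4 C4"
    by (rule lk.run_appendE[OF assms(2)[unfolded D(1)]])
  obtain r' tr2 tr3 C2 C3 where
    r2: "lk.run (map (shift_step k) L) r r' tr2 C2" "lk.run B r' [] tr3 C3"
    by (rule lk.run_appendE[OF r1(2)])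
  note r = r1(1) r2
  obtain L' where L': "L = Cap 0 # L'" using D(2,3) by (rule closed_nonempty_Cap)
  \<comment> \<open>The first piece of the shifted \<open>L\<close> is a cap at position
    \<open>k\<close>, which requires \<open>k\<close> strands to its left.\<close>
  have "k \<le> length r" using r(2) unfolding L'
    by (auto simp: lk.run_Cons dest: lk.lstep_length)
  define a b where "a = take k r" and "b = drop k r"
  have ab: "r = a @ [] @ b" "length a = k" using \<open>k \<le> length r\<close> by (auto simp: a_def b_def)
  obtain r0 C0 where L: "r' = a @ r0 @ b" "lk.run L [] r0 tr2 C0"
  proof (rule lk.run_frameE)
    show "lk.run (map (shift_step (length a)) L) (a @ [] @ b) r' tr2 C2"
      using r(2) ab by simp
    show "tangle (length []) L 0" using D(2) by (simp add: closed_def)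
  qed
  have "r0 = []" using lk.run_tangle[OF L(2)] D(2) tangle_unique[of 0 L "length r0" 0]
    by (simp add: closed_def)
  have "r' = r" using L(1) ab \<open>r0 = []\<close> by simp
  from lk.run_append[OF r(1) r(3)[unfolded this]]
  have "lk.run (A @ B) [] [] (tr1 @ tr3) (C1 \<union> C3)" .
  then have C13: "C1 \<union> C3 \<noteq> {}" using D(4) by (rule lk_run_closed_nonempty)
  let ?f = "map (\<lambda>l :: bool \<times> bool. (False, snd l))"
  obtain t1 c1 where 1: "lk.run A [] (?f r) t1 c1" "total t1 = 0" "fst ` c1 \<subseteq> {False}"
    "C1 \<noteq> {} \<longrightarrow> c1 \<noteq> {}" using lk_run_recolour[OF r(1), of False] unfolding list.map by blast
  obtain t3 c3 where 3: "lk.run B (?f r') [] t3 c3" "total t3 = 0" "fst ` c3 \<subseteq> {False}"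
    "C3 \<noteq> {} \<longrightarrow> c3 \<noteq> {}" using lk_run_recolour[OF r(3), of False] unfolding list.map by blast
  obtain t2 c2 where 2: "lk.run L [] [] t2 c2" "total t2 = 0" "fst ` c2 \<subseteq> {True}"
    using lk_run_recolour[OF L(2)[unfolded \<open>r0 = []\<close>], of True] unfolding list.map
    by blast
  have "c2 \<noteq> {}" using 2(1) D(3) by (rule lk_run_closed_nonempty)
  let ?c2 = "lk.labs (?f a) \<union> lk.labs (?f b) \<union> c2"
  have "lk.run (map (shift_step k) L) (?f r) (?f r') t2 ?c2"
    using lk.run_frame[OF 2(1), of "?f a" "?f b"] ab \<open>r' = r\<close> by simp
  then have "lk.run D [] [] (t1 @ t2 @ t3) (c1 \<union> (?c2 \<union> c3))"
    unfolding D(1) by (rule lk.run_append[OF 1(1) lk.run_append[OF _ 3(1)]])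
  moreover have "total (t1 @ t2 @ t3) = 0" using 1(2) 2(2) 3(2) by simp
  moreover have "fst ` (c1 \<union> (?c2 \<union> c3)) = UNIV"
  proof -
    have "fst ` c2 = {True}" using 2(3) \<open>c2 \<noteq> {}\<close> by auto
    moreover have "c1 \<union> c3 \<noteq> {}" using 1(4) 3(4) C13 by blast
    then have "False \<in> fst ` c1 \<or> False \<in> fst ` c3"
      using 1(3) 3(3) by blast
    ultimately show ?thesis unfolding UNIV_bool image_Un by auto
  qed
  ultimately show ?thesis by (intro exI conjI)
qed

text \<open>The given run only provides an orientation. It is carried to the separated diagram,
  recoloured there to use both colours with total 0, and carried back to \<open>D\<close>.\<close>

lemma not_splittable_if_linked:
  assumes "lk.run D [] [] tr0 C0"
    and "\<And>tr C. lk.run D [] [] tr C \<Longrightarrow> fst ` C = UNIV \<Longrightarrow> total tr \<noteq> 0"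
  shows "\<not> splittable D"
proof
  assume "splittable D"
  then obtain D' where D': "equivalent D D'" "separated_by_circle D'"
    unfolding splittable_def by blast
  obtain tr where "lk.run D' [] [] tr C0"
    using lk.run_equivalent[OF D'(1) assms(1)] by blast
  from lk_run_separated[OF D'(2) this] obtain tr1 C1 where
    D1: "lk.run D' [] [] tr1 C1" "total tr1 = 0" "fst ` C1 = UNIV"
    by blast
  have "equivalent D' D"
    using D'(1) unfolding equivalent_def by (rule equivclp_sym)
  from lk.run_equivalent[OF this D1(1)] obtain tr2 where "lk.run D [] [] tr2 C1" "total tr2 = total tr1"
    by blast
  then show False using assms(2) D1 by simp
qed

section \<open>The game\<close>

lemma no_legal_move_if_all_resolved: "legal_move P P' \<Longrightarrow> \<not> all_resolved P"
  by (auto simp: all_resolved_def elim!: legal_move.cases dest!: nth_mem) 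

lemma opponent_neq [simp]: "opponent p \<noteq> p" "p \<noteq> opponent p"
  by (cases p; simp)+

lemma to_move_snoc: "to_move first (H @ [P]) = opponent (to_move first H)"
  by (cases first) (auto simp: to_move_def)

text \<open>\<open>I\<close> holds whenever the opponent is to move, and the strategy picks any
  reply that restores it. As such a reply always exists, the last crossing is never resolved by the
  opponent, so \<open>I\<close> holds in the final position.\<close>

lemma winning_strategy_by_invariant:
  assumes reply: "\<And>P P'. I P \<Longrightarrow> legal_move P P' \<Longrightarrow> \<exists>P''. legal_move P' P'' \<and> I P''"
    and win: "\<And>P. I P \<Longrightarrow> all_resolved P \<Longrightarrow> wins p (final_diagram P)"
    and start: "if first = p then \<exists>P. legal_move (initial_position S) P \<and> I P else I (initial_position S)"
  shows "has_winning_strategy p first S"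
proof -
  define \<sigma> where "\<sigma> H = (SOME P. legal_move (last H) P \<and> I P)" for H
  have \<sigma>: "legal_move (last H) (\<sigma> H) \<and> I (\<sigma> H)" if "\<exists>P. legal_move (last H) P \<and> I P" for H
    unfolding \<sigma>_def using that by (rule someI_ex)
  have inv: "if to_move first H = p then \<exists>P. legal_move (last H) P \<and> I P else I (last H)"
    if "follows p first S \<sigma> H" for H
    using that
  proof induction
    case start
    have "to_move first [initial_position S] = first" by (simp add: to_move_def)
    then show ?case using assms(3) by simp
  next
    case (own_move H)
    then show ?case using \<sigma>[of H] by (simp add: to_move_snoc)
  next
    case (opponent_move H P)
    then have "I (last H)" by simp
    then have "\<exists>P''. legal_move P P'' \<and> I P''" using reply opponent_move.hyps(3) by blast
    moreover have "opponent (opponent p) = p" by (cases p) auto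
    ultimately show ?case using opponent_move.hyps(2) by (simp add: to_move_snoc)
  qed
  show ?thesis
    unfolding has_winning_strategy_def winning_strategy_def
  proof (intro exI[of _ \<sigma>] allI impI)
    fix H assume H: "follows p first S \<sigma> H"
    show "if all_resolved (last H) then wins p (final_diagram (last H))
      else to_move first H = p \<longrightarrow> legal_move (last H) (\<sigma> H)"
      using inv[OF H] win[of "last H"] \<sigma>[of H] no_legal_move_if_all_resolved[of "last H"]
      by (auto split: if_splits)
  qed
qed

lemma player_wins_by_invariant:
  assumes reply: "\<And>P P'. I P \<Longrightarrow> legal_move P P' \<Longrightarrow> \<exists>P''. legal_move P' P'' \<and> I P''"
    and win: "\<And>P. I P \<Longrightarrow> all_resolved P \<Longrightarrow> wins p (final_diagram P)"
  shows "I (initial_position S) \<Longrightarrow> has_winning_strategy p (opponent p) S"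
    and "legal_move (initial_position S) P \<Longrightarrow> I P \<Longrightarrow> has_winning_strategy p p S"
proof -
  show "has_winning_strategy p (opponent p) S" if "I (initial_position S)"
    by (rule winning_strategy_by_invariant[where I = I, OF reply win]) (use that in simp_all)
  show "has_winning_strategy p p S" if "legal_move (initial_position S) P" "I P"
    by (rule winning_strategy_by_invariant[where I = I, OF reply win]) (use that in auto)
qed

section \<open>Positions as partial maps on named crossings\<close>

definition crossing_labels :: "'x step list \<Rightarrow> 'x list" where
  "crossing_labels w = concat (map (\<lambda>t. case t of Cross i x \<Rightarrow> [x] | _ \<Rightarrow> []) w)"

lemma crossing_labels_simps [simp]: "crossing_labels [] = []"
  "crossing_labels (Cap i # w) = crossing_labels w" "crossing_labels (Cup i # w) = crossing_labels w"
  "crossing_labels (Cross i x # w) = x # crossing_labels w"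
  "crossing_labels (w @ w') = crossing_labels w @ crossing_labels w'"
  by (simp_all add: crossing_labels_def)

lemma set_crossing_labels: "set (crossing_labels w) = {x. \<exists>i. Cross i x \<in> set w}"
  by (induction w) (auto simp: crossing_labels_def split: step.splits)

text \<open>The diagram \<open>W\<close> names the crossings of the shadow, and \<open>g\<close> is the current resolution.\<close>

definition position :: "nat step list \<Rightarrow> (nat \<Rightarrow> slope option) \<Rightarrow> position" where
  "position W g = map (map_step g) W"

lemma map_step_eq_Cross: "map_step g t = Cross i y \<longleftrightarrow> (\<exists>x. t = Cross i x \<and> y = g x)"
  by (cases t) auto

lemma all_resolved_position: "all_resolved (position W g) \<longleftrightarrow> (\<forall>k\<in>set (crossing_labels W). g k \<noteq> None)"
proof -
  have "Cross i None \<in> set (position W g) \<longleftrightarrow> (\<exists>x. Cross i x \<in> set W \<and> g x = None)" for i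
    unfolding position_def by (force simp: image_iff map_step_eq_Cross eq_commute[of "Cross i None"])
  then show ?thesis unfolding all_resolved_def set_crossing_labels by auto
qed

lemma map_step_update:
  assumes "distinct (crossing_labels W)" "h < length W" "W ! h = Cross i k"
  shows "(map (map_step g) W)[h := Cross i y] = map (map_step (g(k := y))) W"
  using assms
proof (induction W arbitrary: h)
  case (Cons t W)
  show ?case
  proof (cases h)
    case 0
    then have "k \<notin> set (crossing_labels W)" using Cons.prems by simp
    then have "map_step (g(k := y)) u = map_step g u" if "u \<in> set W" for u
      using that unfolding set_crossing_labels by (cases u) auto
    then have "map (map_step (g(k := y))) W = map (map_step g) W" by (rule map_cong[OF refl])
    moreover have "t = Cross i k" using 0 Cons.prems by simp
    ultimately show ?thesis unfolding 0 by (simp only: list.map list_update_code step.map fun_upd_same)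
  next
    case (Suc h')
    then have "k \<in> set (crossing_labels W)"
      using Cons.prems unfolding set_crossing_labels by (metis (mono_tags) Suc_less_eq length_Cons mem_Collect_eq nth_Cons_Suc nth_mem)
    then have "map_step (g(k := y)) t = map_step g t" using Cons.prems(1) by (cases t) auto
    moreover have "distinct (crossing_labels W)" using Cons.prems(1) by (cases t) auto
    then have "(map (map_step g) W)[h' := Cross i y] = map (map_step (g(k := y))) W"
      using Cons.IH[of h'] Cons.prems Suc by (simp del: fun_upd_apply)
    ultimately show ?thesis unfolding Suc by (simp only: list.map list_update_code)
  qed
qed simp

lemma legal_move_position:
  assumes "distinct (crossing_labels W)"
  shows "legal_move (position W g) P \<longleftrightarrow>
    (\<exists>k\<in>set (crossing_labels W). \<exists>x. g k = None \<and> P = position W (g(k := Some x)))"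
proof
  assume "legal_move (position W g) P"
  then obtain h i x where *: "h < length (position W g)" "position W g ! h = Cross i None"
    "P = (position W g)[h := Cross i (Some x)]"
    by cases blast
  then obtain k where "W ! h = Cross i k" "g k = None"
    by (auto simp: position_def map_step_eq_Cross)
  moreover have "k \<in> set (crossing_labels W)" unfolding set_crossing_labels
    using * calculation nth_mem[of h W] by (auto simp: position_def intro!: exI[of _ i])
  ultimately show "\<exists>k\<in>set (crossing_labels W). \<exists>x. g k = None \<and> P = position W (g(k := Some x))"
    using * map_step_update[OF assms, of h i k g] by (auto simp: position_def)
next
  assume "\<exists>k\<in>set (crossing_labels W). \<exists>x. g k = None \<and> P = position W (g(k := Some x))"
  then obtain k x i h where *: "g k = None" "P = position W (g(k := Some x))" "h < length W" "W ! h = Cross i k"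
    unfolding set_crossing_labels in_set_conv_nth by auto
  then have "P = (position W g)[h := Cross i (Some x)]"
    using map_step_update[OF assms, of h i k g] by (simp add: position_def)
  then show "legal_move (position W g) P"
    using * legal_move.intros[of h "position W g" i x] by (simp add: position_def)
qed

section \<open>Outcome of a complete resolution\<close>

text \<open>The total of a run without the factor common to all its values; that factor is 1 or -1
  when the two strands are coloured differently.\<close>

definition linking :: "connection \<Rightarrow> (bool \<times> 'x) list \<Rightarrow> ('x \<Rightarrow> slope) \<Rightarrow> int" where
  "linking s ls f = total (zip (map f (map snd ls)) (weights (- 1) s ls))"

lemma linking_simps [simp]: "linking s [] f = 0"
  "linking s ((b, x) # ls) f =
    (if turn b s = s then 0 else sgn_slope (f x) * (- 1) ^ length (selfs (turn b s) ls)) + linking (turn b s) ls f"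
  by (auto simp: linking_def)

lemma set_selfs_mutuals: "set (map snd ls) = set (selfs s ls) \<union> set (mutuals s ls)"
  by (induction s ls rule: selfs.induct) auto

lemma disjoint_selfs_mutuals:
  "distinct (map snd ls) \<Longrightarrow> set (selfs s ls) \<inter> set (mutuals s ls) = {} \<and> distinct (mutuals s ls) \<and> distinct (selfs s ls)"
proof (induction s ls rule: selfs.induct)
  case (2 s b x ls)
  then show ?case using set_selfs_mutuals[of ls "turn b s"] by auto
qed simp

lemma linking_cong: "(\<And>k. k \<in> set (mutuals s ls) \<Longrightarrow> f k = f' k) \<Longrightarrow> linking s ls f = linking s ls f'"
  by (induction s ls rule: mutuals.induct) (auto split: if_splits)

text \<open>The name \<open>k\<close> occurs once, with coefficient 1 or -1, so the two values
  differ by 2. In particular they are not both 0.\<close>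

lemma linking_update:
  assumes "distinct (map snd ls)" "k \<in> set (mutuals s ls)"
  shows "linking s ls (f(k := Positive)) \<noteq> linking s ls (f(k := Negative))"
  using assms
proof (induction s ls rule: mutuals.induct)
  case (2 s b x ls)
  show ?case
  proof (cases "x = k")
    case True
    then have k: "k \<notin> set (map snd ls)" using 2 by auto
    then have "turn b s \<noteq> s" using 2 True set_selfs_mutuals[of ls "turn b s"] by (auto split: if_splits)
    moreover have "linking (turn b s) ls (f(k := Positive)) = linking (turn b s) ls (f(k := Negative))"
      using k set_selfs_mutuals[of ls "turn b s"] by (intro linking_cong) auto
    ultimately show ?thesis using True by (simp add: sgn_slope_def del: fun_upd_apply add: fun_upd_same)
  next
    case False
    then show ?thesis using 2 by (auto split: if_splits)
  qed
qed simp

lemma even_mutuals: "even (length (mutuals s ls)) \<longleftrightarrow> (s = Cro \<longleftrightarrow> connect s ls = Cro)"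
proof (induction s ls rule: mutuals.induct)
  case (2 s b x ls)
  then show ?case by (cases s; cases b) auto
qed simp

lemma relabel_simps:
  "connect s (map (apsnd g) ls) = connect s ls"
  "selfs s (map (apsnd g) ls) = map g (selfs s ls)"
  "mutuals s (map (apsnd g) ls) = map g (mutuals s ls)"
  "linking s (map (apsnd g) ls) f = linking s ls (f \<circ> g)"
  by (induction s ls rule: mutuals.induct) auto

lemma map_step_shift_step: "map_step g (shift_step i t) = shift_step i (map_step g t)"
  by (cases t) auto

lemma map_step_twist: "map (map_step g) (twist b x T) = twist b (g x) (map (map_step g) T)"
  by (cases b) auto

lemma map_step_build: "map (map_step g) (build ls) = build (map (apsnd g) ls)"
  by (induction ls rule: rev_induct) (auto simp: map_step_twist)

lemma map_step_tangle_closure: "map (map_step g) (tangle_closure k T) = tangle_closure k (map (map_step g) T)"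
  by (cases k) (auto simp: map_step_shift_step)

lemma crossing_labels_shift: "crossing_labels (map (shift_step i) T) = crossing_labels T"
proof (induction T)
  case (Cons t T)
  then show ?case by (cases t) auto
qed simp

lemma crossing_labels_closure: "crossing_labels (tangle_closure k (build ls)) = map snd ls"
proof -
  have "crossing_labels (twist b x T) = crossing_labels T @ [x]" for b and x :: 'a and T
    by (cases b) auto
  then have "crossing_labels (build ls) = map snd ls" by (induction ls rule: rev_induct) auto
  then show ?thesis by (cases k) (auto simp: crossing_labels_shift)
qed

lemma total_zip_mult: "total (zip xs (map (\<lambda>e. e * m) es)) = m * total (zip xs es)"
  by (induction xs es rule: list_induct2') (auto simp: algebra_simps)

lemma lk_joins_refl:
  "lk.joins s x (if s = Hor then rev_dir x else x) x (if s = Hor then rev_dir x else x)"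
  by (cases s) simp_all

lemma not_splittable_if_linking:
  assumes "connect Vert ls = closing k" "linking Vert ls (\<lambda>x. x) \<noteq> 0"
  shows "\<not> splittable (tangle_closure k (build ls))"
proof -
  \<comment> \<open>One colour for both strands suffices here, since this run only certifies that
    the closure can be oriented.\<close>
  define x y :: "bool \<times> bool" where "x = (True, True)" and "y = (if closing k = Hor then rev_dir x else x)"
  have "lk.joins (connect Vert ls) x y x y"
    unfolding y_def assms(1) by (rule lk_joins_refl)
  from lk.run_build_exists[OF this] obtain tr0 C0 where "lk.run (build ls) [x, y] [x, y] tr0 C0"
    by blast
  then have run0: "lk.run (tangle_closure k (build ls)) [] [] tr0 C0"
    unfolding lk.run_closure[OF tangle_build] using \<open>lk.joins (connect Vert ls) x y x y\<close> assms(1) by metis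
  show ?thesis
  proof (rule not_splittable_if_linked[OF run0])
    fix tr C
    assume "lk.run (tangle_closure k (build ls)) [] [] tr C" and C: "fst ` C = UNIV"
    then obtain x y z w where run: "lk.run (build ls) [x, y] [z, w] tr C"
      unfolding lk.run_closure[OF tangle_build] by blast
    define q where "q = lk.other (connect Vert ls) y z"
    have "C \<subseteq> lk.labs [x, q]" unfolding q_def by (rule lk.run_buildD(3)[OF run])
    then have "fst ` C \<subseteq> fst ` lk.labs [x, q]" by (rule image_mono)
    then have "fst ` C \<subseteq> {fst x, fst q}" by (simp add: insert_commute)
    \<comment> \<open>Both colours occur, so the colour that \<open>x\<close> lacks must be that of
      \<open>q\<close>.\<close>
    then have "(\<not> fst x) \<in> {fst x, fst q}" unfolding C by blast
    then have "fst x \<noteq> fst q" by auto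
    then have "meet_sign x q \<noteq> 0" by (cases x; cases q) auto
    moreover have "tr = zip (map snd ls) (map (\<lambda>e. e * meet_sign x q) (weights (- 1) Vert ls))"
      unfolding q_def by (rule lk.run_buildD(2)[OF run])
    then have "total tr = meet_sign x q * linking Vert ls (\<lambda>x. x)"
      by (simp add: total_zip_mult linking_def)
    ultimately show "total tr \<noteq> 0" using assms(2) by simp
  qed
qed

section \<open>Untwisting a whole tangle\<close>

fun paired :: "slope list \<Rightarrow> bool" where
  "paired (x # y # xs) \<longleftrightarrow> y = flip x \<and> paired xs"
| "paired _ \<longleftrightarrow> True"

fun untwisted :: "connection \<Rightarrow> slope \<Rightarrow> slope step list" where
  "untwisted Vert x = []"
| "untwisted Hor x = [Cup 0, Cap 0]"
| "untwisted Cro x = [Cross 0 x]"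

lemma twist_eq: "twist b x T = (if b then twist_bottom x T else twist_right x T)"
  by (cases b) (auto simp: twist_bottom_def twist_right_def)

lemma twist_cong: "tangle_equiv 2 2 T T' \<Longrightarrow> tangle_equiv 2 2 (twist b x T) (twist b x T')"
  by (auto simp: twist_eq twist_bottom_cong twist_right_cong)

text \<open>Self-intersections are kinks and vanish with either slope. A constraint arises only on
  leaving or, equivalently, cancelling the one crossing of type \<open>Cro\<close>.\<close>

lemma twist_untwisted:
  assumes "s = Cro \<Longrightarrow> y = flip x"
  shows "tangle_equiv 2 2 (twist b y (untwisted s x)) (untwisted (turn b s) y)"
  using assms twist_right_vert twist_bottom_hor twist_bottom_cross twist_right_cross twist_right_hor
  by (cases s; cases b) (auto simp: twist_eq twist_bottom_def)

text \<open>In type \<open>Cro\<close> the slope \<open>x\<close> belongs to a crossing that still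
  waits for its partner, so it is put in front of the remaining slopes. A last slope without partner
  remains if the tangle ends in type \<open>Cro\<close>.\<close>

lemma foldl_twist_untwisted:
  assumes "tangle_equiv 2 2 T (untwisted s x)" "paired ((if s = Cro then [x] else []) @ mutuals s ls)"
  shows "\<exists>x'. tangle_equiv 2 2 (foldl (\<lambda>T (b, x). twist b x T) T ls) (untwisted (connect s ls) x')"
  using assms
proof (induction ls arbitrary: s x T)
  case (Cons l ls)
  obtain b y where l: "l = (b, y)" by fastforce
  have flip: "s = Cro \<Longrightarrow> y = flip x" using Cons.prems(2) l by (cases b) auto
  have "tangle_equiv 2 2 (twist b y T) (untwisted (turn b s) y)"
    using tangle_equiv_trans[OF twist_cong[OF Cons.prems(1)] twist_untwisted[OF flip]] by simp
  moreover have "paired ((if turn b s = Cro then [y] else []) @ mutuals (turn b s) ls)"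
    using Cons.prems(2) l by (cases s; cases b) auto
  ultimately show ?case using Cons.IH l by simp
qed auto

lemma splittable_if_paired:
  assumes "connect Vert ls = closing k" "paired (mutuals Vert ls)"
  shows "splittable (tangle_closure k (build ls))"
proof -
  \<comment> \<open>The fold starts in type \<open>Vert\<close>, where the slope argument of
    \<open>untwisted\<close> is ignored.\<close>
  obtain x where x: "tangle_equiv 2 2 (build ls) (untwisted (closing k) x)"
    using foldl_twist_untwisted[of "[]" Vert undefined ls] assms by (auto simp: build_def)
  show ?thesis
  proof (cases k)
    case Numerator
    then have "tangle_equiv 0 0 ([Cap 0] @ build ls @ [Cup 0]) ([Cap 0] @ [Cup 0, Cap 0] @ [Cup 0])"
      using x by (intro tangle_equiv_context[of 2 2]) auto
    then have "equivalent (tangle_closure k (build ls)) [Cap 0, Cup 0, Cap 0, Cup 0]"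
      using Numerator by (auto dest: equivalent_if_tangle_equiv)
    moreover have "separated_by_circle [Cap 0, Cup 0, Cap 0, Cup 0]"
      unfolding separated_by_circle_def
      by (intro exI[of _ "[]"] exI[of _ "[Cap 0, Cup 0]"] exI[of _ 0]) (simp add: closed_def)
    ultimately show ?thesis unfolding splittable_def by blast
  next
    case Denominator
    have "tangle_equiv 4 4 (map (shift_step 1) (build ls)) (map (shift_step 1) [])"
      using tangle_equiv_strands_right[OF tangle_equiv_strands_left[OF x, of 1], of 1] Denominator
      by (simp add: eval_nat_numeral)
    from tangle_equiv_context[OF this, of 0 "[Cap 0, Cap 2]" "[Cup 2, Cup 0]" 0]
    have "equivalent (tangle_closure k (build ls)) [Cap 0, Cap 2, Cup 2, Cup 0]"
      using Denominator by (auto dest!: equivalent_if_tangle_equiv simp: eval_nat_numeral)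
    \<comment> \<open>Two circles side by side: the right one is \<open>L\<close>, placed to the
      right of both strands of the left one, hence \<open>k = 2\<close>.\<close>
    moreover have "separated_by_circle [Cap 0, Cap 2, Cup 2, Cup 0]"
      unfolding separated_by_circle_def
      by (intro exI[of _ "[Cap 0]"] exI[of _ "[Cap 0, Cup 0]"] exI[of _ "[Cup 0]"] exI[of _ 2])
         (simp add: closed_def)
    ultimately show ?thesis unfolding splittable_def by blast
  qed
qed

text \<open>\<open>\<pi>\<close> swaps neighbours in the list, first with second, third with fourth
  and so on. It tells the Unlinker where to answer.\<close>

lemma paired_involution:
  assumes "distinct ks" "even (length ks)"
  obtains \<pi> where "\<And>k. k \<in> set ks \<Longrightarrow> \<pi> k \<in> set ks \<and> \<pi> k \<noteq> k \<and> \<pi> (\<pi> k) = k"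
    "\<And>g. (\<And>k. k \<in> set ks \<Longrightarrow> g (\<pi> k) = flip (g k)) \<Longrightarrow> paired (map g ks)"
proof -
  have "\<exists>\<pi>. (\<forall>k\<in>set ks. \<pi> k \<in> set ks \<and> \<pi> k \<noteq> k \<and> \<pi> (\<pi> k) = k) \<and>
    (\<forall>g. (\<forall>k\<in>set ks. g (\<pi> k) = flip (g k)) \<longrightarrow> paired (map g ks))"
    using assms
  proof (induction ks rule: induct_list012)
    case (3 x y zs)
    then obtain \<pi> where \<pi>: "\<forall>k\<in>set zs. \<pi> k \<in> set zs \<and> \<pi> k \<noteq> k \<and> \<pi> (\<pi> k) = k"
      "\<forall>g. (\<forall>k\<in>set zs. g (\<pi> k) = flip (g k)) \<longrightarrow> paired (map g zs)"
      by auto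
    have xy: "x \<noteq> y" "x \<notin> set zs" "y \<notin> set zs" using 3 by auto
    let ?\<pi> = "\<pi>(x := y, y := x)"
    have *: "?\<pi> k = \<pi> k" if "k \<in> set zs" for k using that xy by auto
    have "?\<pi> k \<in> set (x # y # zs) \<and> ?\<pi> k \<noteq> k \<and> ?\<pi> (?\<pi> k) = k" if k: "k \<in> set (x # y # zs)" for k
    proof (cases "k \<in> set zs")
      case True
      then show ?thesis using \<pi>(1) * by (metis list.set_intros(2))
    next
      case False
      then show ?thesis using k xy by auto
    qed
    moreover have "paired (map g (x # y # zs))" if "\<forall>k\<in>set (x # y # zs). g (?\<pi> k) = flip (g k)" for g
    proof -
      have "g (?\<pi> x) = flip (g x)" using that by simp
      then have "g y = flip (g x)" using xy by simp
      moreover have "\<forall>k\<in>set zs. g (\<pi> k) = flip (g k)" using that * by simp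
      ultimately show ?thesis using \<pi>(2) by simp
    qed
    ultimately show ?case by blast
  qed auto
  then show thesis using that by blast
qed

section \<open>Strategies\<close>

definition unresolved :: "'k set \<Rightarrow> ('k \<Rightarrow> slope option) \<Rightarrow> 'k set" where
  "unresolved K g = {k \<in> K. g k = None}"

lemma unresolved_update: "unresolved K (g(k := Some x)) = unresolved K g - {k}"
  by (auto simp: unresolved_def)

lemma unresolved_None [simp]: "unresolved K (\<lambda>_. None) = K"
  by (simp add: unresolved_def)

lemma finite_unresolved: "finite K \<Longrightarrow> finite (unresolved K g)"
  by (simp add: unresolved_def)

lemma opponent_opponent [simp]: "opponent (opponent p) = p"
  by (cases p) auto

lemma odd_card_ex: "odd (card A) \<Longrightarrow> \<exists>k. k \<in> A"
  by (metis card.empty even_zero ex_in_conv)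

lemma even_card_Diff: "finite A \<Longrightarrow> k \<in> A \<Longrightarrow> even (card (A - {k})) \<longleftrightarrow> odd (card A)"
  by (metis card_Suc_Diff1 even_Suc)

text \<open>Player \<open>p\<close> keeps \<open>Q\<close> invariant by answering every move with a move at a crossing of the same
  kind, \<open>S\<close> or \<open>M\<close>.\<close>

lemma wins_by_parity:
  assumes W: "distinct (crossing_labels W)" "set (crossing_labels W) = S \<union> M" "S \<inter> M = {}"
    and start: "Q (\<lambda>_. None)" "initial_position D = position W (\<lambda>_. None)"
    and self: "\<And>g k x. Q g \<Longrightarrow> k \<in> S \<Longrightarrow> Q (g(k := Some x))"
    and mutual: "\<And>g k x. Q g \<Longrightarrow> k \<in> M \<Longrightarrow> g k = None \<Longrightarrow>
      \<exists>k'\<in>M. \<exists>x'. k' \<noteq> k \<and> g k' = None \<and> Q (g(k := Some x, k' := Some x'))"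
    and win: "\<And>g. Q g \<Longrightarrow> \<forall>k\<in>S \<union> M. g k \<noteq> None \<Longrightarrow> wins p (map (map_step (the \<circ> g)) W)"
  shows "even (card S) \<Longrightarrow> has_winning_strategy p (opponent p) D"
    and "odd (card S) \<Longrightarrow> has_winning_strategy p p D"
proof -
  \<comment> \<open>\<open>g\<close> is the resolution before an opponent's move. Evenness ensures
    that every move in \<open>S\<close> can be answered in \<open>S\<close>; by \<open>self\<close>
    the slope of that answer may be arbitrary.\<close>
  define I where "I P \<longleftrightarrow> (\<exists>g. P = position W g \<and> even (card (unresolved S g)) \<and> Q g)" for P
  have fin: "finite S" using W(2) by (metis finite_Un finite_set)
  have move: "legal_move (position W g) (position W (g(k := Some x)))" if "k \<in> S \<union> M" "g k = None" for g k x
    using that unfolding legal_move_position[OF W(1)] W(2) by blast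
  have reply: "\<exists>P''. legal_move P' P'' \<and> I P''" if I: "I P" and m: "legal_move P P'" for P P'
  proof -
    obtain g where g: "P = position W g" "even (card (unresolved S g))" "Q g"
      using I unfolding I_def by blast
    obtain k x where k: "k \<in> S \<union> M" "g k = None" "P' = position W (g(k := Some x))"
      using m unfolding g(1) legal_move_position[OF W(1)] W(2) by blast
    let ?g = "g(k := Some x)"
    show ?thesis
    proof (cases "k \<in> S")
      case True
      then have "k \<in> unresolved S g" using k(2) by (simp add: unresolved_def)
      then have odd: "odd (card (unresolved S ?g))"
        using g(2) even_card_Diff[OF finite_unresolved[OF fin]] unfolding unresolved_update by blast
      then obtain k' where k': "k' \<in> unresolved S ?g" using odd_card_ex by blast
      then have "k' \<in> S" "?g k' = None" by (simp_all add: unresolved_def)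
      moreover have "even (card (unresolved S (?g(k' := Some Positive))))"
        using odd even_card_Diff[OF finite_unresolved[OF fin] k'] unfolding unresolved_update[of S ?g] by blast
      moreover have "Q (?g(k' := Some Positive))"
        using self[OF self[OF g(3) True] \<open>k' \<in> S\<close>] .
      ultimately show ?thesis using move[of k' ?g Positive] unfolding I_def k(3) by blast
    next
      case False
      then have "k \<in> M" using k(1) by blast
      from mutual[OF g(3) this k(2), of x] obtain k' x' where
        k': "k' \<in> M" "k' \<noteq> k" "g k' = None" "Q (?g(k' := Some x'))" by blast
      have "k' \<notin> S" using k'(1) W(3) by blast
      then have "unresolved S (?g(k' := Some x')) = unresolved S g"
        using False unfolding unresolved_update by (auto simp: unresolved_def)
      then have "I (position W (?g(k' := Some x')))" unfolding I_def using g(2) k'(4) by metis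
      moreover have "legal_move P' (position W (?g(k' := Some x')))"
        unfolding k(3) using k' by (intro move) simp_all
      ultimately show ?thesis by blast
    qed
  qed
  have winning: "wins p (final_diagram P)" if P: "I P" "all_resolved P" for P
  proof -
    obtain g where g: "P = position W g" "Q g" using P(1) unfolding I_def by blast
    have "final_diagram P = map (map_step (the \<circ> g)) W"
      by (simp add: g(1) final_diagram_def position_def step.map_comp)
    then show ?thesis
      using win[OF g(2)] P(2) unfolding g(1) all_resolved_position W(2) by simp
  qed
  show "has_winning_strategy p (opponent p) D" if "even (card S)"
  proof (rule player_wins_by_invariant(1)[of I])
    show "I (initial_position D)" unfolding I_def start(2) using that start(1)
      by (intro exI[of _ "\<lambda>_. None"]) simp
  qed (fact reply winning)+
  \<comment> \<open>An opening move in \<open>S\<close> leaves an even number there, after which the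
    player answers as the second player would.\<close>
  show "has_winning_strategy p p D" if odd: "odd (card S)"
  proof -
    obtain k where k: "k \<in> S" using odd_card_ex[OF odd] by blast
    have "even (card (unresolved S ((\<lambda>_. None)(k := Some Positive))))"
      unfolding unresolved_update using even_card_Diff[OF fin k] odd by simp
    then have I: "I (position W ((\<lambda>_. None)(k := Some Positive)))"
      unfolding I_def using self[OF start(1) k] by blast
    have "legal_move (initial_position D) (position W ((\<lambda>_. None)(k := Some Positive)))"
      unfolding start(2) using k by (intro move) simp_all
    from player_wins_by_invariant(2)[of I, OF _ _ this I] show ?thesis
      using reply winning by blast
  qed
qed

lemma initial_position_shadow:
  "initial_position (shadow (map (map_step g) W)) = position W (\<lambda>_. None)"
  by (simp add: initial_position_def shadow_def position_def step.map_comp comp_def)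

lemma wins_rational:
  assumes dist: "distinct (map snd ls)" and con: "connect Vert ls = closing k"
    and nonempty: "mutuals Vert ls \<noteq> []"
    and D: "initial_position D = position (tangle_closure k (build ls)) (\<lambda>_. None)"
  shows "even (length (selfs Vert ls)) \<Longrightarrow> has_winning_strategy p (opponent p) D"
    and "odd (length (selfs Vert ls)) \<Longrightarrow> has_winning_strategy p p D"
proof -
  let ?W = "tangle_closure k (build ls)" and ?S = "set (selfs Vert ls)" and ?M = "set (mutuals Vert ls)"
  have SM: "?S \<inter> ?M = {}" "distinct (mutuals Vert ls)" "distinct (selfs Vert ls)"
    using disjoint_selfs_mutuals[OF dist] by blast+
  have W: "distinct (crossing_labels ?W)" "set (crossing_labels ?W) = ?S \<union> ?M"
    unfolding crossing_labels_closure using dist by (simp_all add: set_selfs_mutuals[of ls Vert, simplified])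
  have even: "even (length (mutuals Vert ls))"
    using even_mutuals[of Vert ls] con by (cases k) auto
  have final: "map (map_step f) ?W = tangle_closure k (build (map (apsnd f) ls))" for f
    by (simp add: map_step_tangle_closure map_step_build)
  have con': "connect Vert (map (apsnd f) ls) = closing k" for f :: "nat \<Rightarrow> slope"
    using con by (simp add: relabel_simps)
  have "\<exists>Q. Q (\<lambda>_. None) \<and> (\<forall>g k x. Q g \<longrightarrow> k \<in> ?S \<longrightarrow> Q (g(k := Some x))) \<and>
    (\<forall>g k x. Q g \<longrightarrow> k \<in> ?M \<longrightarrow> g k = None \<longrightarrow>
      (\<exists>k'\<in>?M. \<exists>x'. k' \<noteq> k \<and> g k' = None \<and> Q (g(k := Some x, k' := Some x')))) \<and>
    (\<forall>g. Q g \<longrightarrow> (\<forall>k\<in>?S \<union> ?M. g k \<noteq> None) \<longrightarrow> wins p (map (map_step (the \<circ> g)) ?W))"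
  proof (cases p)
    case Linker
    \<comment> \<open>Evenness before each opponent's move leaves the last non-self-intersection to
      the Linker. At the start the second clause holds vacuously because \<open>mutuals\<close> is
      nonempty.\<close>
    define Q where "Q g \<longleftrightarrow> even (card (unresolved ?M g)) \<and>
      (unresolved ?M g = {} \<longrightarrow> linking Vert ls (the \<circ> g) \<noteq> 0)" for g
    have "Q (\<lambda>_. None)"
      unfolding Q_def using even nonempty by (simp add: distinct_card[OF SM(2)])
    moreover have "Q (g(k := Some x))" if "Q g" "k \<in> ?S" for g k x
    proof -
      have k: "k \<notin> ?M" using that(2) SM(1) by blast
      then have "unresolved ?M (g(k := Some x)) = unresolved ?M g"
        unfolding unresolved_update by (auto simp: unresolved_def)
      moreover have "linking Vert ls (the \<circ> g(k := Some x)) = linking Vert ls (the \<circ> g)"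
        using k by (intro linking_cong) auto
      ultimately show ?thesis using that(1) unfolding Q_def by simp
    qed
    moreover have "\<exists>k'\<in>?M. \<exists>x'. k' \<noteq> k \<and> g k' = None \<and> Q (g(k := Some x, k' := Some x'))"
      if "Q g" "k \<in> ?M" "g k = None" for g k x
    proof -
      let ?g = "g(k := Some x)"
      have fin: "finite (unresolved ?M g')" for g' by (simp add: finite_unresolved)
      have "k \<in> unresolved ?M g" using that(2,3) by (simp add: unresolved_def)
      then have odd: "odd (card (unresolved ?M ?g))"
        using that(1) even_card_Diff[OF fin] unfolding unresolved_update Q_def by blast
      then obtain k' where k': "k' \<in> unresolved ?M ?g" using odd_card_ex by blast
      have even': "even (card (unresolved ?M (?g(k' := Some x'))))" for x'
        using odd even_card_Diff[OF fin k'] unfolding unresolved_update[of ?M ?g] by blast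
      have k'': "k' \<in> ?M" "k' \<noteq> k" "g k' = None"
        using k' by (auto simp: unresolved_def split: if_splits)
      \<comment> \<open>Unresolved crossings are counted with the value \<open>the None\<close>. The
        choice of \<open>x'\<close> matters only when \<open>k'\<close> is the last open one, but a
        suitable slope exists in every case.\<close>
      have "the \<circ> ?g(k' := Some x') = (the \<circ> ?g)(k' := x')" for x' by auto
      then obtain x' where "linking Vert ls (the \<circ> ?g(k' := Some x')) \<noteq> 0"
        using linking_update[OF dist k''(1), of "the \<circ> ?g"] by metis
      then have "Q (?g(k' := Some x'))" unfolding Q_def using even' by blast
      then show ?thesis using k'' by blast
    qed
    moreover have "wins p (map (map_step (the \<circ> g)) ?W)" if "Q g" "\<forall>k\<in>?S \<union> ?M. g k \<noteq> None" for g
    proof -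
      have "unresolved ?M g = {}" using that(2) by (auto simp: unresolved_def)
      then have "linking Vert (map (apsnd (the \<circ> g)) ls) (\<lambda>x. x) \<noteq> 0"
        using that(1) unfolding Q_def by (simp add: relabel_simps comp_def)
      from not_splittable_if_linking[OF con' this] show ?thesis
        unfolding final Linker by simp
    qed
    ultimately show ?thesis by blast
  next
    case Unlinker
    obtain \<pi> where \<pi>: "\<And>k. k \<in> ?M \<Longrightarrow> \<pi> k \<in> ?M \<and> \<pi> k \<noteq> k \<and> \<pi> (\<pi> k) = k"
      "\<And>g. (\<And>k. k \<in> ?M \<Longrightarrow> g (\<pi> k) = flip (g k)) \<Longrightarrow> paired (map g (mutuals Vert ls))"
      using paired_involution[OF SM(2) even] by metis
    \<comment> \<open>The equation also covers unresolved crossings: a crossing is open exactly if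
      its partner is, so the partner is available for the answer.\<close>
    define Q where "Q g \<longleftrightarrow> (\<forall>k\<in>?M. g (\<pi> k) = map_option flip (g k))" for g
    have "Q (\<lambda>_. None)" by (simp add: Q_def)
    moreover have "Q (g(k := Some x))" if "Q g" "k \<in> ?S" for g k x
    proof -
      have "k \<notin> ?M" using that(2) SM(1) by blast
      then show ?thesis using that(1) \<pi>(1) unfolding Q_def by auto
    qed
    moreover have "\<exists>k'\<in>?M. \<exists>x'. k' \<noteq> k \<and> g k' = None \<and> Q (g(k := Some x, k' := Some x'))"
      if "Q g" "k \<in> ?M" "g k = None" for g k x
    proof -
      have pk: "\<pi> k \<in> ?M" "\<pi> k \<noteq> k" "\<pi> (\<pi> k) = k" using \<pi>(1)[OF that(2)] by blast+
      have "g (\<pi> k) = None" using that unfolding Q_def by simp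
      moreover have "Q (g(k := Some x, \<pi> k := Some (flip x)))"
        unfolding Q_def
      proof
        fix j assume j: "j \<in> ?M"
        have "\<pi> j \<noteq> k \<and> \<pi> j \<noteq> \<pi> k" if "j \<noteq> k" "j \<noteq> \<pi> k" using \<pi>(1)[OF j] pk that by metis
        then show "(g(k := Some x, \<pi> k := Some (flip x))) (\<pi> j) =
          map_option flip ((g(k := Some x, \<pi> k := Some (flip x))) j)"
          using pk j \<open>Q g\<close> unfolding Q_def by auto
      qed
      ultimately show ?thesis using pk by blast
    qed
    moreover have "wins p (map (map_step (the \<circ> g)) ?W)" if "Q g" "\<forall>k\<in>?S \<union> ?M. g k \<noteq> None" for g
    proof -
      have "(the \<circ> g) (\<pi> k) = flip ((the \<circ> g) k)" if k: "k \<in> ?M" for k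
      proof -
        obtain y where "g k = Some y" using \<open>\<forall>k\<in>?S \<union> ?M. g k \<noteq> None\<close> k by blast
        then show ?thesis using \<open>Q g\<close> k unfolding Q_def by simp
      qed
      from \<pi>(2)[of "the \<circ> g", OF this] have "paired (mutuals Vert (map (apsnd (the \<circ> g)) ls))"
        by (simp add: relabel_simps)
      from splittable_if_paired[OF con' this] show ?thesis
        unfolding final Unlinker by simp
    qed
    ultimately show ?thesis by blast
  qed
  then obtain Q where Q: "Q (\<lambda>_. None)" "\<And>g k x. Q g \<Longrightarrow> k \<in> ?S \<Longrightarrow> Q (g(k := Some x))"
    "\<And>g k x. Q g \<Longrightarrow> k \<in> ?M \<Longrightarrow> g k = None \<Longrightarrow>
      \<exists>k'\<in>?M. \<exists>x'. k' \<noteq> k \<and> g k' = None \<and> Q (g(k := Some x, k' := Some x'))"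
    "\<And>g. Q g \<Longrightarrow> \<forall>k\<in>?S \<union> ?M. g k \<noteq> None \<Longrightarrow> wins p (map (map_step (the \<circ> g)) ?W)"
    by metis
  have card: "card ?S = length (selfs Vert ls)" by (rule distinct_card[OF SM(3)])
  show "has_winning_strategy p (opponent p) D" if "even (length (selfs Vert ls))"
    by (rule wins_by_parity(1)[where Q = Q, OF W SM(1) Q(1) D Q(2-4)]) (use that card in simp_all)
  show "has_winning_strategy p p D" if "odd (length (selfs Vert ls))"
    by (rule wins_by_parity(2)[where Q = Q, OF W SM(1) Q(1) D Q(2-4)]) (use that card in simp_all)
qed

section \<open>Rational tangle words as lists of twists\<close>

lemma funpow_twist: "(twist b x ^^ j) (build ls) = build (ls @ replicate j (b, x))"
proof (induction j)
  case (Suc j)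
  have "ls @ replicate (Suc j) (b, x) = (ls @ replicate j (b, x)) @ [(b, x)]"
    by (simp add: replicate_append_same)
  then show ?case using Suc by (simp only: build_simps funpow.simps comp_def)
qed simp

lemma rational_tangle_eq_build: "\<exists>ls. rational_tangle a = build ls"
proof -
  have twist: "twist_bottom x = twist True x" "twist_right x = twist False x" for x
    by (auto simp: twist_bottom_def twist_right_def)
  have "\<exists>ls'. fold add_syllable xs (build ls) = build ls'" for xs ls
  proof (induction xs arbitrary: ls)
    case (Cons ik xs)
    have "\<exists>ls'. add_syllable ik (build ls) = build ls'"
      by (cases ik) (auto simp: add_syllable_def twist funpow_twist)
    then show ?case using Cons.IH by auto
  qed auto
  from this[of _ "[]"] show ?thesis by (simp add: rational_tangle_def)
qed

theorem theorem1p2: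
  fixes a :: "int list" and c :: closure_kind
  assumes two_components: "two_component_link (tangle_closure c (rational_tangle a))"
    and components_cross: "non_self_intersections (rational_tangle a) \<noteq> {}"
  shows
    "(even (card (self_intersections (rational_tangle a))) \<longrightarrow>
        (\<forall>first. has_winning_strategy (opponent first) first
          (shadow (tangle_closure c (rational_tangle a))))) \<and>
     (odd (card (self_intersections (rational_tangle a))) \<longrightarrow>
        (\<forall>first. has_winning_strategy first first
          (shadow (tangle_closure c (rational_tangle a)))))"
proof -
  obtain ls where ls: "rational_tangle a = build ls" using rational_tangle_eq_build by blast
  \<comment> \<open>Crossings are named by their index, which makes the names distinct. The map
    \<open>f\<close> restores the slopes of the word, which the shadow forgets.\<close>
  define ks where "ks = zip (map fst ls) [0..<length ls]"
  define f where "f k = snd (ls ! k)" for k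
  have ls_ks: "ls = map (apsnd f) ks"
    by (rule nth_equalityI) (auto simp: ks_def f_def prod_eq_iff)
  have dist: "distinct (map snd ks)" by (simp add: ks_def)
  have con: "connect Vert ks = closing c"
    using connect_eq_closing[of c ls] two_components ls ls_ks by (simp add: relabel_simps)
  have nonempty: "mutuals Vert ks \<noteq> []"
    using mutuals_nonempty[of ls] components_cross ls ls_ks by (simp add: relabel_simps)
  have card: "card (self_intersections (rational_tangle a)) = length (selfs Vert ks)"
    using card_self_intersections[of ls] ls ls_ks by (simp add: relabel_simps)
  have "tangle_closure c (rational_tangle a) = map (map_step f) (tangle_closure c (build ks))"
    unfolding ls map_step_tangle_closure map_step_build ls_ks[symmetric] ..
  then have D: "initial_position (shadow (tangle_closure c (rational_tangle a))) =
      position (tangle_closure c (build ks)) (\<lambda>_. None)"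
    by (simp only: initial_position_shadow)
  show ?thesis
    unfolding card using wins_rational[OF dist con nonempty D] by (metis opponent_opponent)
qed

end
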